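(* Let $x(t)=(\xi_0,\vartheta(t))$ be a circular $T$-periodic solution ($T$ the prime period) of the Euler–Lagrange equation of the Lagrangian $L(\xi,\vartheta,\dot\xi,\dot\vartheta)=\frac12 p(\xi)\big[\dot\xi^2+\xi^2\dot\vartheta^2\big]+q(\xi)$, and let $a,b,c,d$ be the constants associated with $x$ defined in the context. Then the Morse index of $x$ is $$m^-(x)=\begin{cases}2k &\text{if } d<0 \text{ and } cd+b^2\ge 0,\\ 2k+1 &\text{if } d<0\text{ and } cd+b^2<0,\\ 0 &\text{if } \big(d=0,\ b=0,\ c>0\big)\ \text{or}\ \big(d=0,\ b\ne 0\big)\ \text{or}\ \big(d>0,\ cd+b^2>0\big),\end{cases}$$ where, when $d<0$, $k\in\mathbb N=\{0,1,2,\dots\}$ is the integer determined by $2\pi k<\sqrt{-ad}\;T\le 2\pi(k+1)$.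
   Context: Setting: $p,q$ are smooth real functions on an open interval $I\subset(0,+\infty)$ with $p>0$; $(\xi,\vartheta)$ are polar coordinates in the plane, with $\xi\in I$. Put $\eta(\xi)=p(\xi)\xi^2$; a prime denotes $d/d\xi$ and a subscript $0$ denotes evaluation at $\xi_0$. Circular solution: a solution $x(t)=(\xi_0,\vartheta_0+\dot\vartheta_0 t)$ of the Euler–Lagrange equations with constant radius $\xi_0\in I$ and constant angular velocity $\dot\vartheta_0>0$, where $\eta_0'\neq 0$; then $\dot\vartheta_0^2=-2q_0'/\eta_0'>0$ and the prime period is $T=2\pi/\dot\vartheta_0$. Constants: $$a=p_0^{-1},\quad b=\eta_0^{-1}\zeta_0,\quad c=\eta_0^{-1},\quad d=2q_0'\frac{\eta_0'}{\eta_0}+\eta_0'\Big(\frac{q'}{\eta'}\Big)'(\xi_0),$$ where $\zeta_0=\sqrt{-2q_0'\eta_0'}$ if $\eta_0'\ge 0$ and $\zeta_0=-\sqrt{-2q_0'\eta_0'}$ if $\eta_0'<0$. In particular $a>0$. Morse index: $m^-(x)$ is the maximal dimension of a linear subspace of $W^{1,2}(\mathbb R/T\mathbb Z,\mathbb R^2)$ on which the second variation at $x$ of the action $\int_0^T L\,dt$ (on $H^1$ $T$-periodic loops in the punctured plane), $$I(u,u)=\int_0^T\langle P\dot u,\dot u\rangle+2\langle Qu,\dot u\rangle+\langle Ru,u\rangle\,dt,$$ is negative definite, where $P=L_{vv}$, $Q=L_{vx}$, $R=L_{xx}$ are evaluated along $x$ ($x=(\xi,\vartheta)$ position and $v=(\dot\xi,\dot\vartheta)$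 velocity variables). *)

theory Defs
  imports "HOL-Analysis.Analysis"
begin

definition smooth_on :: "real set \<Rightarrow> (real \<Rightarrow> real) \<Rightarrow> bool" where
  "smooth_on S f \<longleftrightarrow> (\<forall>n. \<forall>s\<in>S. ((deriv ^^ n) f) field_differentiable (at s))"

section \<open>Lagrangians on the plane\<close>

type_synonym lagrangian = "real^2 \<Rightarrow> real^2 \<Rightarrow> real"

definition partial_x :: "2 \<Rightarrow> lagrangian \<Rightarrow> lagrangian" where
  "partial_x i L = (\<lambda>x v. deriv (\<lambda>s. L (x + s *\<^sub>R axis i 1) v) 0)"

definition partial_v :: "2 \<Rightarrow> lagrangian \<Rightarrow> lagrangian" where
  "partial_v i L = (\<lambda>x v. deriv (\<lambda>s. L x (v + s *\<^sub>R axis i 1)) 0)"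

definition velocity :: "(real \<Rightarrow> real^2) \<Rightarrow> real \<Rightarrow> real^2" where
  "velocity x t = vector_derivative x (at t)"

definition solves_euler_lagrange :: "lagrangian \<Rightarrow> (real \<Rightarrow> real^2) \<Rightarrow> bool" where
  "solves_euler_lagrange L x \<longleftrightarrow>
     (\<forall>t. x differentiable (at t)) \<and>
     (\<forall>t i. ((\<lambda>s. partial_v i L (x s) (velocity x s)) has_real_derivative
              partial_x i L (x t) (velocity x t)) (at t))"

definition L_vv :: "lagrangian \<Rightarrow> real^2 \<Rightarrow> real^2 \<Rightarrow> real^2^2" where
  "L_vv L x v = (\<chi> i j. partial_v j (partial_v i L) x v)"

text \<open>The row index of \<open>L_vx\<close> belongs to the velocity and the column index to the position, so
  that \<open>(L_vx L x v *v u) \<bullet> u'\<close> pairs \<open>u\<close> with position and \<open>u'\<close> with velocity derivatives.\<close>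

definition L_vx :: "lagrangian \<Rightarrow> real^2 \<Rightarrow> real^2 \<Rightarrow> real^2^2" where
  "L_vx L x v = (\<chi> i j. partial_x j (partial_v i L) x v)"

definition L_xx :: "lagrangian \<Rightarrow> real^2 \<Rightarrow> real^2 \<Rightarrow> real^2^2" where
  "L_xx L x v = (\<chi> i j. partial_x j (partial_x i L) x v)"

section \<open>The Sobolev space of periodic loops\<close>

definition L2_per :: "real \<Rightarrow> (real \<Rightarrow> real^2) set" where
  "L2_per T = {f. (\<forall>t. f (t + T) = f t) \<and> f \<in> borel_measurable borel \<and>
                  set_integrable lborel {0..T} (\<lambda>t. (norm (f t))\<^sup>2)}"

definition is_weak_derivative :: "real \<Rightarrow> (real \<Rightarrow> real^2) \<Rightarrow> (real \<Rightarrow> real^2) \<Rightarrow> bool" where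
  "is_weak_derivative T u v \<longleftrightarrow>
     (\<forall>\<phi>. smooth_on UNIV \<phi> \<and> (\<forall>t. \<phi> (t + T) = \<phi> t) \<longrightarrow>
        (LBINT t:{0..T}. deriv \<phi> t *\<^sub>R u t) = - (LBINT t:{0..T}. \<phi> t *\<^sub>R v t))"

text \<open>An element of \<open>W\<^sup>1\<^sup>,\<^sup>2\<close> is an almost-everywhere class of functions; in dimension one each class
  has exactly one continuous representative, and that representative is periodic, hence bounded.
  The space is therefore realised inside the real vector space of bounded continuous functions,
  where distinct functions are distinct classes.\<close>

definition W12_per :: "real \<Rightarrow> (real \<Rightarrow>\<^sub>C (real^2)) set" where
  "W12_per T = {u. apply_bcontfun u \<in> L2_per T \<and>
                   (\<exists>v\<in>L2_per T. is_weak_derivative T (apply_bcontfun u) v)}"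

text \<open>The weak derivative is unique up to null sets, so integrals do not depend on the choice.\<close>

definition weak_derivative :: "real \<Rightarrow> (real \<Rightarrow>\<^sub>C (real^2)) \<Rightarrow> real \<Rightarrow> real^2" where
  "weak_derivative T u = (SOME v. v \<in> L2_per T \<and> is_weak_derivative T (apply_bcontfun u) v)"

section \<open>Second variation and Morse index\<close>

definition second_variation ::
    "lagrangian \<Rightarrow> real \<Rightarrow> (real \<Rightarrow> real^2) \<Rightarrow> (real \<Rightarrow>\<^sub>C (real^2)) \<Rightarrow> real" where
  "second_variation L T x u =
     (let u' = weak_derivative T u;
          P = (\<lambda>t. L_vv L (x t) (velocity x t));
          Q = (\<lambda>t. L_vx L (x t) (velocity x t));
          R = (\<lambda>t. L_xx L (x t) (velocity x t))
      in LBINT t:{0..T}. (P t *v u' t) \<bullet> u' t + 2 * ((Q t *v u t) \<bullet> u' t) + (R t *v u t) \<bullet> u t)"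

text \<open>Since \<^const>\<open>dim\<close> is \<open>0\<close> on infinite-dimensional subspaces, only finite-dimensional ones enter
  the supremum; a negative definite subspace of infinite dimension contains ones of every finite
  dimension, so the supremum is then \<open>\<infinity>\<close>. A finite supremum is attained, hence a maximum.\<close>

definition morse_index :: "lagrangian \<Rightarrow> real \<Rightarrow> (real \<Rightarrow> real^2) \<Rightarrow> enat" where
  "morse_index L T x =
     Sup {enat (dim V) | V. subspace V \<and> V \<subseteq> W12_per T \<and> (\<exists>B. finite B \<and> V = span B) \<and>
                            (\<forall>u\<in>V. u \<noteq> 0 \<longrightarrow> second_variation L T x u < 0)}"

section \<open>The radial Lagrangian in polar coordinates\<close>

text \<open>Component \<open>1\<close> is the radius and component \<open>2\<close> the angle; the angle is not reduced
  modulo \<open>2 * pi\<close>, so a closed loop may increase it by a multiple of \<open>2 * pi\<close>, whereas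
  variations of the loop are periodic in both components.\<close>

definition polar_lagrangian :: "(real \<Rightarrow> real) \<Rightarrow> (real \<Rightarrow> real) \<Rightarrow> lagrangian" where
  "polar_lagrangian p q x v =
     1/2 * p (x $ 1) * ((v $ 1)\<^sup>2 + (x $ 1)\<^sup>2 * (v $ 2)\<^sup>2) + q (x $ 1)"

definition eta :: "(real \<Rightarrow> real) \<Rightarrow> real \<Rightarrow> real" where
  "eta p \<xi> = p \<xi> * \<xi>\<^sup>2"

definition circular_solution ::
    "(real \<Rightarrow> real) \<Rightarrow> (real \<Rightarrow> real) \<Rightarrow> real set \<Rightarrow> real \<Rightarrow> real \<Rightarrow> (real \<Rightarrow> real^2) \<Rightarrow> bool" where
  "circular_solution p q I \<xi>\<^sub>0 \<omega> x \<longleftrightarrow>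
     \<xi>\<^sub>0 \<in> I \<and> \<omega> > 0 \<and> deriv (eta p) \<xi>\<^sub>0 \<noteq> 0 \<and>
     (\<exists>\<theta>\<^sub>0. \<forall>t. x t = vector [\<xi>\<^sub>0, \<theta>\<^sub>0 + \<omega> * t]) \<and>
     solves_euler_lagrange (polar_lagrangian p q) x"

definition zeta :: "(real \<Rightarrow> real) \<Rightarrow> (real \<Rightarrow> real) \<Rightarrow> real \<Rightarrow> real" where
  "zeta p q \<xi> = (if deriv (eta p) \<xi> \<ge> 0 then sqrt (- 2 * deriv q \<xi> * deriv (eta p) \<xi>)
                 else - sqrt (- 2 * deriv q \<xi> * deriv (eta p) \<xi>))"

definition coef_a :: "(real \<Rightarrow> real) \<Rightarrow> real \<Rightarrow> real" where
  "coef_a p \<xi> = inverse (p \<xi>)"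

definition coef_b :: "(real \<Rightarrow> real) \<Rightarrow> (real \<Rightarrow> real) \<Rightarrow> real \<Rightarrow> real" where
  "coef_b p q \<xi> = inverse (eta p \<xi>) * zeta p q \<xi>"

definition coef_c :: "(real \<Rightarrow> real) \<Rightarrow> real \<Rightarrow> real" where
  "coef_c p \<xi> = inverse (eta p \<xi>)"

definition coef_d :: "(real \<Rightarrow> real) \<Rightarrow> (real \<Rightarrow> real) \<Rightarrow> real \<Rightarrow> real" where
  "coef_d p q \<xi> = 2 * deriv q \<xi> * (deriv (eta p) \<xi> / eta p \<xi>)
     + deriv (eta p) \<xi> * deriv (\<lambda>r. deriv q r / deriv (eta p) r) \<xi>"

end

(* Completing the square turns the second variation into the integral of
     p u1'^2 + d u1^2 + eta (u2' + b u1)^2,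
   because (L_vx) only couples u1 with u2' and the radial Euler-Lagrange equation gives
   omega^2 = -2 q'/eta'. As u2' has mean zero, b u1 and u2' + b u1 have the same mean, and apart
   from that mean u2' + b u1 is free. On the nonconstant harmonics of u1 of frequency n the form is
   therefore governed by the sign of p (n omega)^2 + d, with multiplicity two, and on the constants
   by the sign of d + eta b^2. The upper bound for the index uses a Wirtinger inequality for
   functions whose first k frequencies vanish (Bessel for the derivative and Parseval, by
   Stone-Weierstrass on the circle, for the function); the lower bound evaluates the form on
   explicit trigonometric loops, for which weak and classical derivative must be identified. *)
theory Submission
  imports Defs
begin

section \<open>Orthogonal systems and dimension counting\<close>

text \<open>The form sees the second component only through \<open>u2' + b u1\<close>, so all
  functionals and test loops can be indexed by harmonics of \<open>u1\<close> alone. One finite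
  index set serves both bounds: its modes span a negative definite space, and the vanishing of its
  coefficients makes the form nonnegative, so the two counts agree. A frequency with p (n omega)^2 +
  d = 0 only enlarges the kernel; hence the strict lower and weak upper bound on \<open>k\<close>.
  The main obstacle is that \<open>weak_derivative\<close> is picked by \<open>SOME\<close>, so it
  is known only as some L2 function with prescribed integrals against smooth periodic functions. The
  upper bound needs just those integrals. On explicit loops it must be known almost everywhere, so
  the density of trigonometric polynomials is used a second time, to show that harmonics separate
  integrable functions.\<close>

definition square_integrable :: "'a measure \<Rightarrow> ('a \<Rightarrow> real) \<Rightarrow> bool" where
  "square_integrable M f \<longleftrightarrow> f \<in> borel_measurable M \<and> integrable M (\<lambda>t. (f t)\<^sup>2)"

lemma square_integrable_mult:
  assumes "square_integrable M f" "square_integrable M g"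
  shows "integrable M (\<lambda>t. f t * g t)"
proof (rule Bochner_Integration.integrable_bound)
  show "integrable M (\<lambda>t. (f t)\<^sup>2 + (g t)\<^sup>2)"
    using assms by (auto simp: square_integrable_def)
  show "(\<lambda>t. f t * g t) \<in> borel_measurable M"
    using assms by (auto simp: square_integrable_def)
  have "\<bar>x * y\<bar> \<le> x\<^sup>2 + y\<^sup>2" for x y :: real
  proof -
    have "2 * \<bar>x * y\<bar> \<le> x\<^sup>2 + y\<^sup>2"
      using sum_squares_bound[of "\<bar>x\<bar>" "\<bar>y\<bar>"] by (simp add: abs_mult)
    then show ?thesis by linarith
  qed
  then show "AE t in M. norm (f t * g t) \<le> norm ((f t)\<^sup>2 + (g t)\<^sup>2)"
    by auto
qed

lemma square_integrable_add:
  assumes "square_integrable M f" "square_integrable M g"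
  shows "square_integrable M (\<lambda>t. f t + g t)"
  using assms square_integrable_mult[OF assms]
  by (auto simp: square_integrable_def power2_sum mult.assoc)

lemma square_integrable_cmult:
  assumes "square_integrable M f"
  shows "square_integrable M (\<lambda>t. c * f t)"
  using assms by (auto simp: square_integrable_def power_mult_distrib)

lemma square_integrable_sum:
  assumes "\<And>j. j \<in> J \<Longrightarrow> square_integrable M (f j)"
  shows "square_integrable M (\<lambda>t. \<Sum>j\<in>J. f j t)"
  using assms
proof (induction J rule: infinite_finite_induct)
  case (insert j J)
  then show ?case by (auto intro!: square_integrable_add)
qed (auto simp: square_integrable_def)

lemma (in finite_measure) square_integrable_const: "square_integrable M (\<lambda>_. c)"
  by (auto simp: square_integrable_def)

lemma (in finite_measure) square_integrable_integrable:
  assumes "square_integrable M f"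
  shows "integrable M f"
  using square_integrable_mult[OF assms square_integrable_const[of 1]] by simp

text \<open>Orthogonality kills the off-diagonal products. The coefficients stay arbitrary because
  three choices are used: Fourier coefficients for Bessel, those of a uniform approximant for
  Parseval, and any with \<open>g = 0\<close> for norms of finite sums.\<close>

lemma integral_square_diff_sum:
  fixes \<phi> :: "'i \<Rightarrow> 'a \<Rightarrow> real"
  assumes "finite J" and g: "square_integrable M g"
    and \<phi>: "\<And>j. j \<in> J \<Longrightarrow> square_integrable M (\<phi> j)"
    and orth: "\<And>i j. i \<in> J \<Longrightarrow> j \<in> J \<Longrightarrow> (\<integral>t. \<phi> i t * \<phi> j t \<partial>M) = (if i = j then h j else 0)"
  shows "(\<integral>t. (g t - (\<Sum>j\<in>J. c j * \<phi> j t))\<^sup>2 \<partial>M)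
    = (\<integral>t. (g t)\<^sup>2 \<partial>M) - 2 * (\<Sum>j\<in>J. c j * (\<integral>t. \<phi> j t * g t \<partial>M)) + (\<Sum>j\<in>J. (c j)\<^sup>2 * h j)"
proof -
  let ?S = "\<lambda>t. \<Sum>j\<in>J. c j * \<phi> j t"
  have S: "square_integrable M ?S"
    by (intro square_integrable_sum square_integrable_cmult \<phi>)
  have "(\<integral>t. (g t - ?S t)\<^sup>2 \<partial>M) = (\<integral>t. (g t)\<^sup>2 + (?S t)\<^sup>2 - 2 * (?S t * g t) \<partial>M)"
    by (intro Bochner_Integration.integral_cong) (auto simp: power2_diff)
  also have "\<dots> = (\<integral>t. (g t)\<^sup>2 \<partial>M) + (\<integral>t. (?S t)\<^sup>2 \<partial>M) - 2 * (\<integral>t. ?S t * g t \<partial>M)"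
    using g S square_integrable_mult[OF S g] by (simp add: square_integrable_def)
  also have "(\<integral>t. ?S t * g t \<partial>M) = (\<integral>t. (\<Sum>j\<in>J. c j * (\<phi> j t * g t)) \<partial>M)"
    by (simp add: sum_distrib_right mult.assoc)
  also have "\<dots> = (\<Sum>j\<in>J. c j * (\<integral>t. \<phi> j t * g t \<partial>M))"
    using square_integrable_mult[OF \<phi> g] by (subst Bochner_Integration.integral_sum) auto
  also have "(\<integral>t. (?S t)\<^sup>2 \<partial>M) = (\<integral>t. (\<Sum>i\<in>J. \<Sum>j\<in>J. c i * c j * (\<phi> i t * \<phi> j t)) \<partial>M)"
    by (simp add: power2_eq_square sum_product mult_ac)
  also have "\<dots> = (\<Sum>i\<in>J. \<Sum>j\<in>J. c i * c j * (\<integral>t. \<phi> i t * \<phi> j t \<partial>M))"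
  proof (subst Bochner_Integration.integral_sum)
    show "integrable M (\<lambda>t. \<Sum>j\<in>J. c i * c j * (\<phi> i t * \<phi> j t))" if "i \<in> J" for i
      using square_integrable_mult[OF \<phi> \<phi>] that by auto
    show "(\<Sum>i\<in>J. \<integral>t. (\<Sum>j\<in>J. c i * c j * (\<phi> i t * \<phi> j t)) \<partial>M)
      = (\<Sum>i\<in>J. \<Sum>j\<in>J. c i * c j * (\<integral>t. \<phi> i t * \<phi> j t \<partial>M))"
      using square_integrable_mult[OF \<phi> \<phi>]
      by (intro sum.cong refl, subst Bochner_Integration.integral_sum) auto
  qed
  also have "\<dots> = (\<Sum>i\<in>J. \<Sum>j\<in>J. if i = j then (c j)\<^sup>2 * h j else 0)"
    by (intro sum.cong refl) (simp add: orth power2_eq_square)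
  also have "\<dots> = (\<Sum>j\<in>J. (c j)\<^sup>2 * h j)"
    using \<open>finite J\<close> by simp
  finally show ?thesis by simp
qed

text \<open>Each \<open>c j\<close> enters through a quadratic that is minimal at the Fourier
  coefficient, so any approximant, however obtained, bounds the defect in Bessel's
  inequality.\<close>

lemma best_approximation:
  fixes \<phi> :: "'i \<Rightarrow> 'a \<Rightarrow> real"
  assumes "finite J" and g: "square_integrable M g"
    and \<phi>: "\<And>j. j \<in> J \<Longrightarrow> square_integrable M (\<phi> j)"
    and orth: "\<And>i j. i \<in> J \<Longrightarrow> j \<in> J \<Longrightarrow> (\<integral>t. \<phi> i t * \<phi> j t \<partial>M) = (if i = j then h j else 0)"
    and h: "\<And>j. j \<in> J \<Longrightarrow> h j > 0"
  shows "(\<integral>t. (g t)\<^sup>2 \<partial>M) - (\<Sum>j\<in>J. (\<integral>t. \<phi> j t * g t \<partial>M)\<^sup>2 / h j)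
    \<le> (\<integral>t. (g t - (\<Sum>j\<in>J. c j * \<phi> j t))\<^sup>2 \<partial>M)"
proof -
  let ?a = "\<lambda>j. \<integral>t. \<phi> j t * g t \<partial>M"
  have "2 * c j * ?a j \<le> (c j)\<^sup>2 * h j + (?a j)\<^sup>2 / h j" if "j \<in> J" for j
  proof -
    have "0 \<le> (c j * h j - ?a j)\<^sup>2 / h j"
      using h[OF that] by simp
    also have "\<dots> = (c j)\<^sup>2 * h j + (?a j)\<^sup>2 / h j - 2 * c j * ?a j"
      using h[OF that] by (simp add: field_simps power2_eq_square)
    finally show ?thesis by simp
  qed
  then have "(\<Sum>j\<in>J. 2 * c j * ?a j) \<le> (\<Sum>j\<in>J. (c j)\<^sup>2 * h j + (?a j)\<^sup>2 / h j)"
    by (rule sum_mono)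
  then show ?thesis
    unfolding integral_square_diff_sum[OF \<open>finite J\<close> g \<phi> orth, simplified]
    by (simp add: sum.distrib sum_distrib_left mult.assoc)
qed

lemma Bessel_inequality:
  fixes \<phi> :: "'i \<Rightarrow> 'a \<Rightarrow> real"
  assumes "finite J" and g: "square_integrable M g"
    and \<phi>: "\<And>j. j \<in> J \<Longrightarrow> square_integrable M (\<phi> j)"
    and orth: "\<And>i j. i \<in> J \<Longrightarrow> j \<in> J \<Longrightarrow> (\<integral>t. \<phi> i t * \<phi> j t \<partial>M) = (if i = j then h j else 0)"
    and h: "\<And>j. j \<in> J \<Longrightarrow> h j > 0"
  shows "(\<Sum>j\<in>J. (\<integral>t. \<phi> j t * g t \<partial>M)\<^sup>2 / h j) \<le> (\<integral>t. (g t)\<^sup>2 \<partial>M)"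
proof -
  let ?a = "\<lambda>j. \<integral>t. \<phi> j t * g t \<partial>M"
  have "0 \<le> (\<integral>t. (g t - (\<Sum>j\<in>J. ?a j / h j * \<phi> j t))\<^sup>2 \<partial>M)"
    by simp
  also have "\<dots> = (\<integral>t. (g t)\<^sup>2 \<partial>M) - 2 * (\<Sum>j\<in>J. ?a j / h j * ?a j) + (\<Sum>j\<in>J. (?a j / h j)\<^sup>2 * h j)"
    by (rule integral_square_diff_sum) (use assms in auto)
  also have "(\<Sum>j\<in>J. (?a j / h j)\<^sup>2 * h j) = (\<Sum>j\<in>J. ?a j / h j * ?a j)"
    by (intro sum.cong refl) (use h in \<open>fastforce simp: power2_eq_square\<close>)
  finally show ?thesis
    by (simp add: power2_eq_square)
qed

section \<open>Dimension counting with indexed families\<close>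

lemma span_family_independent:
  fixes e :: "'i \<Rightarrow> 'v::real_vector"
  assumes "finite J" and indep: "\<And>c. (\<Sum>j\<in>J. c j *\<^sub>R e j) = 0 \<Longrightarrow> \<forall>j\<in>J. c j = 0"
  shows "dim (span (e ` J)) = card J" "independent (e ` J)" "inj_on e J"
proof -
  show inj: "inj_on e J"
  proof (rule inj_onI)
    fix i j assume ij: "i \<in> J" "j \<in> J" "e i = e j"
    show "i = j"
    proof (rule ccontr)
      assume "i \<noteq> j"
      \<comment> \<open>Two equal members would satisfy the nontrivial relation
        \<open>e i - e j = 0\<close>.\<close>
      let ?c = "\<lambda>l. if l = i then 1 else if l = j then -1 else (0::real)"
      have "(\<Sum>l\<in>J. ?c l *\<^sub>R e l) = (\<Sum>l\<in>{i,j}. ?c l *\<^sub>R e l)"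
        using \<open>finite J\<close> ij by (intro sum.mono_neutral_right) auto
      also have "\<dots> = 0"
        using \<open>i \<noteq> j\<close> ij by simp
      finally have "?c i = 0"
        using indep[of ?c] ij by blast
      then show False by simp
    qed
  qed
  show ind: "independent (e ` J)"
  proof (rule independent_if_scalars_zero)
    fix f x assume "(\<Sum>x\<in>e ` J. f x *\<^sub>R x) = 0" "x \<in> e ` J"
    then show "f x = 0"
      using indep[of "f \<circ> e"] by (auto simp: sum.reindex[OF inj])
  qed (use \<open>finite J\<close> in auto)
  show "dim (span (e ` J)) = card J"
    using dim_span_eq_card_independent[OF ind] card_image[OF inj] by simp
qed

lemma span_image_eq_sums:
  fixes e :: "'i \<Rightarrow> 'v::real_vector"
  assumes "finite J"
  shows "span (e ` J) = {\<Sum>j\<in>J. c j *\<^sub>R e j |c. True}"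
proof
  show "span (e ` J) \<subseteq> {\<Sum>j\<in>J. c j *\<^sub>R e j |c. True}"
  proof (rule span_minimal)
    show "e ` J \<subseteq> {\<Sum>j\<in>J. c j *\<^sub>R e j |c. True}"
    proof clarify
      fix i assume "i \<in> J"
      then have "e i = (\<Sum>j\<in>J. (if j = i then 1 else 0) *\<^sub>R e j)"
        using \<open>finite J\<close> by (simp add: if_distrib[of "\<lambda>r. r *\<^sub>R _"] sum.delta cong: if_cong)
      then show "\<exists>c. e i = (\<Sum>j\<in>J. c j *\<^sub>R e j) \<and> True" by (intro exI[of _ "\<lambda>j. if j = i then 1 else 0"]) simp
    qed
    show "subspace {\<Sum>j\<in>J. c j *\<^sub>R e j |c. True}"
      unfolding subspace_def
    proof (intro conjI ballI allI)
      show "0 \<in> {\<Sum>j\<in>J. c j *\<^sub>R e j |c. True}"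
        by (rule CollectI, rule exI[of _ "\<lambda>_. 0"]) simp
      show "x + y \<in> {\<Sum>j\<in>J. c j *\<^sub>R e j |c. True}"
        if "x \<in> {\<Sum>j\<in>J. c j *\<^sub>R e j |c. True}" "y \<in> {\<Sum>j\<in>J. c j *\<^sub>R e j |c. True}" for x y
      proof -
        from that obtain c c' where "x = (\<Sum>j\<in>J. c j *\<^sub>R e j)" "y = (\<Sum>j\<in>J. c' j *\<^sub>R e j)" by blast
        then have "x + y = (\<Sum>j\<in>J. (c j + c' j) *\<^sub>R e j)"
          by (simp add: scaleR_left_distrib sum.distrib)
        then show ?thesis by (intro CollectI exI[of _ "\<lambda>j. c j + c' j"]) simp
      qed
      show "r *\<^sub>R x \<in> {\<Sum>j\<in>J. c j *\<^sub>R e j |c. True}"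
        if "x \<in> {\<Sum>j\<in>J. c j *\<^sub>R e j |c. True}" for r x
      proof -
        from that obtain c where "x = (\<Sum>j\<in>J. c j *\<^sub>R e j)" by blast
        then have "r *\<^sub>R x = (\<Sum>j\<in>J. (r * c j) *\<^sub>R e j)"
          by (simp add: scaleR_sum_right)
        then show ?thesis by (intro CollectI exI[of _ "\<lambda>j. r * c j"]) simp
      qed
    qed
  qed
  show "{\<Sum>j\<in>J. c j *\<^sub>R e j |c. True} \<subseteq> span (e ` J)"
    by clarify (intro span_sum span_scale, auto intro: span_base)
qed

text \<open>\<open>F\<close> packs the functionals into one linear map with range in a space spanned
  by \<open>card J\<close> vectors, so it cannot be injective on a larger space. The independent
  family \<open>e\<close> only supplies coordinates for tuples indexed by \<open>J\<close>.\<close>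

lemma ex_nonzero_annihilated:
  fixes B :: "'v::real_vector set" and f :: "'i \<Rightarrow> 'v \<Rightarrow> real"
    and e :: "'i \<Rightarrow> 'w::real_vector"
  assumes "finite B" "finite J" "card J < dim (span B)"
    and lin: "\<And>j. j \<in> J \<Longrightarrow> linear (f j)"
    and indep: "\<And>c. (\<Sum>j\<in>J. c j *\<^sub>R e j) = 0 \<Longrightarrow> \<forall>j\<in>J. c j = 0"
  obtains u where "u \<in> span B" "u \<noteq> 0" "\<forall>j\<in>J. f j u = 0"
proof -
  define F where "F u = (\<Sum>j\<in>J. f j u *\<^sub>R e j)" for u
  have F: "linear F"
    unfolding F_def by (intro linear_compose_sum ballI linear_scaleR_left linear_compose[OF lin, unfolded o_def])
       (auto intro: linearI simp: scaleR_left_distrib)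
  have "\<not> inj_on F (span B)"
  proof
    assume inj: "inj_on F (span B)"
    obtain B' where B': "B' \<subseteq> span B" "independent B'" "span B \<subseteq> span B'" "card B' = dim (span B)"
      by (rule basis_exists)
    have "span B' = span B"
      using B' by (metis span_eq span_span subset_antisym span_mono)
    then have inj': "inj_on F (span B')" using inj by simp
    have "independent (F ` B')"
      using linear_independent_injective_image[OF F B'(2) inj'] .
    moreover have "F ` B' \<subseteq> span (e ` J)"
      unfolding F_def by (intro image_subsetI span_sum span_scale) (auto intro: span_base)
    ultimately have "card (F ` B') \<le> card (e ` J)"
      using independent_span_bound \<open>finite J\<close> by blast
    moreover have "card (F ` B') = card B'"
      using inj' by (meson card_image inj_on_subset span_superset)
    ultimately show False
      using B'(4) assms(3) card_image_le[OF \<open>finite J\<close>, of e] by linarith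
  qed
  then obtain u where u: "u \<in> span B" "F u = 0" "u \<noteq> 0"
    using linear_inj_on_iff_eq_0[OF F subspace_span] by blast
  then have "\<forall>j\<in>J. f j u = 0"
    using indep[of "\<lambda>j. f j u"] by (simp add: F_def)
  with u that show thesis by blast
qed

section \<open>Harmonics on a period\<close>

locale loop_period =
  fixes w :: real
  assumes w_pos: "w > 0"
begin

abbreviation T :: real where "T \<equiv> 2 * pi / w"

text \<open>A finite measure replaces the set integrals: square integrable functions are then
  integrable, and the abstract inequalities above apply directly.\<close>

abbreviation M :: "real measure" where "M \<equiv> restrict_space lborel {0..T}"

lemma T_pos: "T > 0"
  using w_pos by simp

lemma finite_measure_M: "finite_measure M"
  by (intro finite_measureI) (simp add: emeasure_restrict_space space_restrict_space emeasure_lborel_Icc_eq)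

sublocale finite_measure M
  by (rule finite_measure_M)

lemma measure_M: "measure M (space M) = T"
  using T_pos by (simp add: measure_restrict_space space_restrict_space)

lemma set_integral_eq: "(LBINT t:{0..T}. f t) = (\<integral>t. f t \<partial>M)"
  for f :: "real \<Rightarrow> 'a::{banach, second_countable_topology}"
  by (simp add: integral_restrict_space set_lebesgue_integral_def)

lemma set_integrable_iff: "set_integrable lborel {0..T} f \<longleftrightarrow> integrable M f"
  for f :: "real \<Rightarrow> 'a::{banach, second_countable_topology}"
  by (simp add: integrable_restrict_space set_integrable_def)

lemma borel_measurable_M: "f \<in> borel_measurable borel \<Longrightarrow> f \<in> borel_measurable M"
  for f :: "real \<Rightarrow> 'a::topological_space"
  by (rule measurable_restrict_space1) simp

lemma continuous_integrable: "continuous_on UNIV f \<Longrightarrow> integrable M f"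
  for f :: "real \<Rightarrow> 'a::euclidean_space"
  unfolding set_integrable_iff[symmetric]
  by (rule borel_integrable_atLeastAtMost') (blast intro: continuous_on_subset)

lemma continuous_square_integrable: "continuous_on UNIV f \<Longrightarrow> square_integrable M f"
  unfolding square_integrable_def
  by (intro conjI borel_measurable_M borel_measurable_continuous_onI continuous_integrable continuous_intros)

lemma integral_derivative:
  fixes F :: "real \<Rightarrow> 'a::euclidean_space"
  assumes "\<And>t. (F has_vector_derivative f t) (at t)" "continuous_on UNIV f"
  shows "(\<integral>t. f t \<partial>M) = F T - F 0"
proof -
  have "has_bochner_integral lborel (\<lambda>x. indicator {0..T} x *\<^sub>R f x) (F T - F 0)"
    by (rule has_bochner_integral_FTC_Icc)
       (use T_pos assms in \<open>auto intro: has_vector_derivative_at_within continuous_on_subset\<close>)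
  then show ?thesis
    by (simp add: has_bochner_integral_iff integral_restrict_space)
qed

text \<open>Carrying a phase closes the family under differentiation up to a factor (phase shift by
  -pi/2) and under products up to sums; the sine has phase pi/2.\<close>

definition wave :: "nat \<Rightarrow> real \<Rightarrow> real \<Rightarrow> real" where
  "wave n \<alpha> t = cos (w * n * t - \<alpha>)"

lemma continuous_wave: "continuous_on S (wave n \<alpha>)"
  unfolding wave_def[abs_def] by (intro continuous_intros)

lemma wave_periodic: "wave n \<alpha> (t + T) = wave n \<alpha> t"
proof -
  have "w * n * (t + T) - \<alpha> = (w * n * t - \<alpha>) + real n * (2 * pi)"
    using w_pos by (simp add: field_simps)
  then show ?thesis
    unfolding wave_def using cos.plus_of_nat[of "w * n * t - \<alpha>" n, unfolded of_real_eq_id id_apply] by metis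
qed

lemma wave_deriv: "(wave n \<alpha> has_real_derivative w * n * wave n (\<alpha> - pi / 2) t) (at t)"
proof -
  have "cos (w * n * t - (\<alpha> - pi / 2)) = - sin (w * n * t - \<alpha>)"
    using minus_sin_cos_eq[of "w * n * t - \<alpha>"] by (simp add: algebra_simps)
  then show ?thesis
    unfolding wave_def[abs_def] by (auto intro!: derivative_eq_intros)
qed

text \<open>\<open>m\<close> is real so that differences of natural frequencies, possibly negative,
  are covered. For nonzero \<open>m\<close> the antiderivative has equal values at both
  ends.\<close>

lemma integral_cos_multiple:
  assumes "m \<in> \<int>"
  shows "(\<integral>t. cos (w * m * t - \<alpha>) \<partial>M) = (if m = 0 then T * cos \<alpha> else 0)"
proof (cases "m = 0")
  case True
  then show ?thesis using measure_M by (simp add: space_restrict_space)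
next
  case False
  obtain k where k: "m = of_int k" using assms by (elim Ints_cases)
  let ?F = "\<lambda>t. sin (w * m * t - \<alpha>) / (w * m)"
  have "(\<integral>t. cos (w * m * t - \<alpha>) \<partial>M) = ?F T - ?F 0"
    by (rule integral_derivative)
       (use False w_pos in \<open>auto intro!: derivative_eq_intros continuous_intros
          simp: has_real_derivative_iff_has_vector_derivative[symmetric]\<close>)
  also have "w * m * T - \<alpha> = - \<alpha> + 2 * pi * of_int k"
    using w_pos k by (simp add: field_simps)
  also have "sin (- \<alpha> + 2 * pi * of_int k) = sin (- \<alpha>)"
    using sin.plus_of_int[of "- \<alpha>" k] by (simp add: mult_ac)
  finally show ?thesis using False by simp
qed

lemma integral_wave_product:
  "(\<integral>t. wave m \<alpha> t * wave n \<beta> t \<partial>M)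
    = T / 2 * ((if m = n then cos (\<alpha> - \<beta>) else 0) + (if m = 0 \<and> n = 0 then cos (\<alpha> + \<beta>) else 0))"
proof -
  let ?A = "\<lambda>t. cos (w * (real m - real n) * t - (\<alpha> - \<beta>))"
  let ?B = "\<lambda>t. cos (w * (real m + real n) * t - (\<alpha> + \<beta>))"
  have "wave m \<alpha> t * wave n \<beta> t = 1/2 * (?A t + ?B t)" for t
    unfolding wave_def by (simp add: cos_times_cos algebra_simps)
  then have "(\<integral>t. wave m \<alpha> t * wave n \<beta> t \<partial>M) = (\<integral>t. 1/2 * (?A t + ?B t) \<partial>M)"
    by presburger
  also have "\<dots> = 1/2 * ((\<integral>t. ?A t \<partial>M) + (\<integral>t. ?B t \<partial>M))"
    by (subst integral_mult_right_zero, subst Bochner_Integration.integral_add)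
       (intro continuous_integrable continuous_intros refl)+
  also have "(\<integral>t. ?A t \<partial>M) = (if m = n then T * cos (\<alpha> - \<beta>) else 0)"
    by (subst integral_cos_multiple) (auto intro: Ints_diff)
  also have "(\<integral>t. ?B t \<partial>M) = (if m = 0 \<and> n = 0 then T * cos (\<alpha> + \<beta>) else 0)"
    by (subst integral_cos_multiple) (auto intro: Ints_add)
  also have "1/2 * ((if m = n then T * cos (\<alpha> - \<beta>) else 0) + (if m = 0 \<and> n = 0 then T * cos (\<alpha> + \<beta>) else 0))
    = T / 2 * ((if m = n then cos (\<alpha> - \<beta>) else 0) + (if m = 0 \<and> n = 0 then cos (\<alpha> + \<beta>) else 0))"
    by (simp add: distrib_left)
  finally show ?thesis .
qed

text \<open>The enumeration is 1, sin, cos, sin 2, cos 2, ...: index 2n - 1 is the sine and 2n the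
  cosine of frequency n, so the indices 1 to 2k are the nonconstant harmonics of frequency at most
  k.\<close>

definition freq :: "nat \<Rightarrow> nat" where "freq j = (j + 1) div 2"

definition phase :: "nat \<Rightarrow> real" where "phase j = (if even j then 0 else pi / 2)"

definition harmonic :: "nat \<Rightarrow> real \<Rightarrow> real" where
  "harmonic j = wave (freq j) (phase j)"

definition harmonic' :: "nat \<Rightarrow> real \<Rightarrow> real" where
  "harmonic' j t = w * freq j * wave (freq j) (phase j - pi / 2) t"

lemma freq_eq_0_iff: "freq j = 0 \<longleftrightarrow> j = 0"
  by (auto simp: freq_def)

lemma freq_0 [simp]: "freq 0 = 0"
  by (simp add: freq_eq_0_iff)

lemma freq_le_iff: "freq j \<le> k \<longleftrightarrow> j \<le> 2 * k"
  unfolding freq_def by presburger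

lemma harmonic_0 [simp]: "harmonic 0 t = 1"
  by (simp add: harmonic_def wave_def phase_def)

lemma freq_eq_cases: "freq i = freq j \<Longrightarrow> i \<noteq> j \<Longrightarrow> even i \<noteq> even j"
  unfolding freq_def by presburger

lemma harmonic_deriv: "(harmonic j has_real_derivative harmonic' j t) (at t)"
  unfolding harmonic_def harmonic'_def by (rule wave_deriv)

lemma harmonic'_deriv: "(harmonic' j has_real_derivative - (w * freq j)\<^sup>2 * harmonic j t) (at t)"
proof -
  have "wave n (\<alpha> - pi / 2 - pi / 2) t = - wave n \<alpha> t" for n \<alpha> t
    unfolding wave_def by (simp add: algebra_simps cos_add cos_diff)
  then show ?thesis
    unfolding harmonic'_def[abs_def] harmonic_def
    by (auto intro!: derivative_eq_intros wave_deriv simp: power2_eq_square)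
qed

lemma continuous_harmonic: "continuous_on S (harmonic j)"
  unfolding harmonic_def by (rule continuous_wave)

lemma continuous_harmonic': "continuous_on S (harmonic' j)"
  unfolding harmonic'_def[abs_def] by (intro continuous_intros continuous_wave)

lemma harmonic_periodic: "harmonic j (t + T) = harmonic j t"
  unfolding harmonic_def by (rule wave_periodic)

lemma harmonic'_periodic: "harmonic' j (t + T) = harmonic' j t"
  unfolding harmonic'_def by (simp add: wave_periodic)

text \<open>This is the squared L2 norm over a period.\<close>

definition harmonic_norm :: "nat \<Rightarrow> real" where
  "harmonic_norm j = (if j = 0 then T else T / 2)"

lemma harmonic_norm_pos: "harmonic_norm j > 0"
  using T_pos by (simp add: harmonic_norm_def)

lemma cos_phase_diff: "freq i = freq j \<Longrightarrow> cos (phase i - phase j) = (if i = j then 1 else 0)"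
  using freq_eq_cases[of i j] by (auto simp: phase_def)

lemma harmonic_orthogonal:
  "(\<integral>t. harmonic i t * harmonic j t \<partial>M) = (if i = j then harmonic_norm j else 0)"
proof -
  have "freq i = 0 \<and> freq j = 0 \<longleftrightarrow> i = 0 \<and> j = 0" by (simp add: freq_eq_0_iff)
  then show ?thesis
    unfolding harmonic_def integral_wave_product
    by (auto simp: cos_phase_diff harmonic_norm_def freq_eq_0_iff) (simp add: phase_def)
qed

lemma harmonic'_orthogonal:
  "(\<integral>t. harmonic' i t * harmonic' j t \<partial>M)
    = (if i = j then (w * freq j)\<^sup>2 * harmonic_norm j else 0)"
proof -
  have "(\<integral>t. harmonic' i t * harmonic' j t \<partial>M)
    = w * freq i * (w * freq j) * (\<integral>t. wave (freq i) (phase i - pi / 2) t * wave (freq j) (phase j - pi / 2) t \<partial>M)"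
    unfolding harmonic'_def by (subst integral_mult_right_zero[symmetric]) (simp add: mult_ac)
  then show ?thesis
    unfolding integral_wave_product
    by (auto simp: cos_phase_diff harmonic_norm_def freq_eq_0_iff power2_eq_square)
qed

subsection \<open>Trigonometric approximation\<close>

text \<open>One coefficient sequence must work for all large degrees, so it contributes nothing
  beyond \<open>N\<^sub>0\<close>, and two polynomials can be added at a common degree without
  padding.\<close>

definition trig_poly :: "(real \<Rightarrow> real) \<Rightarrow> bool" where
  "trig_poly P \<longleftrightarrow> (\<exists>c N\<^sub>0. \<forall>N\<ge>N\<^sub>0. \<forall>t. P t = (\<Sum>j\<le>N. c j * harmonic j t))"

lemma trig_polyE:
  assumes "trig_poly P"
  obtains c N where "P = (\<lambda>t. \<Sum>j\<le>N. c j * harmonic j t)"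
  using assms unfolding trig_poly_def by blast

lemma trig_poly_add:
  assumes "trig_poly P" "trig_poly Q"
  shows "trig_poly (\<lambda>t. P t + Q t)"
proof -
  obtain c c' N N' where
    PQ: "\<And>n t. n \<ge> N \<Longrightarrow> P t = (\<Sum>j\<le>n. c j * harmonic j t)"
    "\<And>n t. n \<ge> N' \<Longrightarrow> Q t = (\<Sum>j\<le>n. c' j * harmonic j t)"
    using assms unfolding trig_poly_def by blast
  show ?thesis
    unfolding trig_poly_def
  proof (intro exI[of _ "\<lambda>j. c j + c' j"] exI[of _ "max N N'"] allI impI)
    fix n t assume "max N N' \<le> n"
    then show "P t + Q t = (\<Sum>j\<le>n. (c j + c' j) * harmonic j t)"
      using PQ(1)[of n t] PQ(2)[of n t] by (simp add: distrib_right sum.distrib)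
  qed
qed

lemma trig_poly_cmult:
  assumes "trig_poly P"
  shows "trig_poly (\<lambda>t. r * P t)"
proof -
  obtain c N where P: "\<And>n t. n \<ge> N \<Longrightarrow> P t = (\<Sum>j\<le>n. c j * harmonic j t)"
    using assms unfolding trig_poly_def by blast
  show ?thesis
    unfolding trig_poly_def
  proof (intro exI[of _ "\<lambda>j. r * c j"] exI[of _ N] allI impI)
    fix n t assume "N \<le> n"
    then show "r * P t = (\<Sum>j\<le>n. (r * c j) * harmonic j t)"
      using P[of n t] by (simp add: sum_distrib_left mult.assoc)
  qed
qed

lemma trig_poly_sum:
  assumes "\<And>j. j \<in> J \<Longrightarrow> trig_poly (P j)"
  shows "trig_poly (\<lambda>t. \<Sum>j\<in>J. P j t)"
  using assms
proof (induction J rule: infinite_finite_induct)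
  case (insert j J)
  then show ?case by (auto intro!: trig_poly_add)
qed (auto simp: trig_poly_def intro!: exI[of _ "\<lambda>_. 0"])

lemma trig_poly_harmonic: "trig_poly (harmonic i)"
  unfolding trig_poly_def
proof (intro exI[of _ "\<lambda>j. if j = i then 1 else 0"] exI[of _ i] allI impI)
  fix N t assume "i \<le> N"
  then show "harmonic i t = (\<Sum>j\<le>N. (if j = i then 1 else 0) * harmonic j t)"
    by (simp add: if_distrib[of "\<lambda>r. r * _"] sum.delta cong: if_cong)
qed

lemma trig_poly_const: "trig_poly (\<lambda>_. r)"
  using trig_poly_cmult[OF trig_poly_harmonic[of 0], of r] by simp

lemma trig_poly_wave: "trig_poly (wave n \<alpha>)"
proof (cases "n = 0")
  case True
  then show ?thesis using trig_poly_const by (simp add: wave_def[abs_def])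
next
  case False
  \<comment> \<open>For n = 0 truncated subtraction would turn the sine index 2n - 1 into 0.\<close>
  have "freq (2 * n) = n" "freq (2 * n - 1) = n" "odd (2 * n - 1)"
    using False by (auto simp: freq_def)
  then have "wave n \<alpha> = (\<lambda>t. cos \<alpha> * harmonic (2 * n) t + sin \<alpha> * harmonic (2 * n - 1) t)"
    unfolding harmonic_def wave_def[abs_def] by (simp add: phase_def cos_diff mult.commute)
  then show ?thesis
    by (auto intro!: trig_poly_add trig_poly_cmult trig_poly_harmonic)
qed

text \<open>By the product-to-sum formula; reducing to m <= n keeps the difference frequency a
  natural number.\<close>

lemma trig_poly_wave_mult: "trig_poly (\<lambda>t. wave m \<alpha> t * wave n \<beta> t)"
proof (induction m n arbitrary: \<alpha> \<beta> rule: linorder_wlog)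
  case (le m n)
  have "wave m \<alpha> t * wave n \<beta> t = 1/2 * wave (n - m) (\<beta> - \<alpha>) t + 1/2 * wave (n + m) (\<alpha> + \<beta>) t" for t
  proof -
    have "cos (w * (real n - real m) * t - (\<beta> - \<alpha>)) = cos (w * m * t - \<alpha> - (w * n * t - \<beta>))"
      by (subst cos_minus[symmetric]) (simp add: algebra_simps)
    then show ?thesis
      using le unfolding wave_def by (simp add: cos_times_cos of_nat_diff) (simp add: algebra_simps)
  qed
  then show ?case
    by (simp only:) (intro trig_poly_add trig_poly_cmult trig_poly_wave)
next
  case (sym m n)
  from sym[of \<beta> \<alpha>] show ?case by (simp add: mult.commute)
qed

lemma trig_poly_mult:
  assumes "trig_poly P" "trig_poly Q"
  shows "trig_poly (\<lambda>t. P t * Q t)"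
proof -
  obtain c N where P: "P = (\<lambda>t. \<Sum>j\<le>N. c j * harmonic j t)" by (rule trig_polyE[OF assms(1)])
  obtain d K where Q: "Q = (\<lambda>t. \<Sum>j\<le>K. d j * harmonic j t)" by (rule trig_polyE[OF assms(2)])
  have "(\<lambda>t. P t * Q t) = (\<lambda>t. \<Sum>i\<le>N. \<Sum>j\<le>K. (c i * d j) * (harmonic i t * harmonic j t))"
    unfolding P Q by (simp add: sum_product mult_ac)
  then show ?thesis
    unfolding harmonic_def
    by (simp only:) (intro trig_poly_sum trig_poly_cmult trig_poly_wave_mult)
qed

lemma trig_poly_continuous: "trig_poly P \<Longrightarrow> continuous_on S P"
  by (elim trig_polyE) (auto intro!: continuous_intros continuous_harmonic)

text \<open>On the unit circle a real-linear functional is a combination of cosine and sine, and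
  trigonometric polynomials form an algebra.\<close>

lemma trig_poly_real_polynomial_cis:
  assumes "real_polynomial_function (G :: complex \<Rightarrow> real)"
  shows "trig_poly (\<lambda>t. G (cis (w * t)))"
  using assms
proof induction
  case (linear f)
  interpret f: bounded_linear f by fact
  have "f (cis (w * t)) = f 1 * wave 1 0 t + f \<i> * wave 1 (pi / 2) t" for t
  proof -
    have "cis (w * t) = cos (w * t) *\<^sub>R 1 + sin (w * t) *\<^sub>R \<i>"
      by (simp add: complex_eq_iff)
    then have "f (cis (w * t)) = cos (w * t) * f 1 + sin (w * t) * f \<i>"
      by (metis f.add f.scaleR real_scaleR_def)
    then show ?thesis
      by (simp add: wave_def cos_diff)
  qed
  then show ?case
    by (simp only:) (intro trig_poly_add trig_poly_cmult trig_poly_wave)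
qed (intro trig_poly_const trig_poly_add trig_poly_mult; assumption)+

lemma trig_approximation:
  assumes "continuous_on {0..T} f" "f 0 = f T" "e > 0"
  obtains P where "trig_poly P" "\<And>t. t \<in> {0..T} \<Longrightarrow> \<bar>f t - P t\<bar> < e"
proof -
  define p where "p s = f (s * T)" for s
  have "continuous_on {0..1} p"
    unfolding p_def
  proof (rule continuous_on_compose2[OF assms(1)])
    show "(\<lambda>s. s * T) ` {0..1} \<subseteq> {0..T}"
      using mult_left_le_one_le[of T] T_pos by (auto simp del: times_divide_eq_right)
  qed (intro continuous_intros)
  then have "path p" by (simp add: path_def)
  moreover have "pathfinish p = pathstart p"
    using assms(2) by (simp add: p_def pathfinish_def pathstart_def)
  \<comment> \<open>Continuity across the seam comes from the constant homotopy: the circle map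
    attached to \<open>p\<close> is an end of the induced homotopy of circle maps.\<close>
  ultimately have "homotopic_loops UNIV p p"
    by (simp add: homotopic_loops_refl)
  then have "continuous_on (sphere 0 1) (p \<circ> (\<lambda>z. Arg2pi z / (2 * pi)))"
    using homotopic_loops_imp_homotopic_circlemaps homotopic_with_imp_continuous by blast
  then obtain G where G: "real_polynomial_function G"
    "\<And>z. z \<in> sphere 0 1 \<Longrightarrow> \<bar>(p \<circ> (\<lambda>z. Arg2pi z / (2 * pi))) z - G z\<bar> < e"
    using Stone_Weierstrass_real_polynomial_function[OF compact_sphere] \<open>e > 0\<close> by metis
  have "\<bar>f t - G (cis (w * t))\<bar> < e" if t: "t \<in> {0..T}" for t
  proof -
    have "p (Arg2pi (cis (w * t)) / (2 * pi)) = f t"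
    \<comment> \<open>At \<open>t = T\<close> the argument jumps back to 0, and the equality of the
      end values takes over.\<close>
    proof (cases "t = T")
      case True
      have "cis (w * t) = 1"
        using True w_pos by (simp add: complex_eq_iff)
      then show ?thesis using True assms(2) Arg2pi_unique[of 1 0 1] by (simp add: p_def)
    next
      case False
      then have "0 \<le> w * t" "w * t < 2 * pi"
        using t w_pos by (auto simp: field_simps)
      then have "Arg2pi (cis (w * t)) = w * t"
        by (intro Arg2pi_unique[of 1]) (auto simp: cis_conv_exp)
      then show ?thesis using w_pos by (simp add: p_def)
    qed
    then show ?thesis using G(2)[of "cis (w * t)"] by simp
  qed
  with trig_poly_real_polynomial_cis[OF G(1)] that show thesis by blast
qed

section \<open>Parseval, completeness of the harmonics and Wirtinger\<close>

lemma space_M: "space M = {0..T}"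
  by (simp add: space_restrict_space)

lemma continuous_Icc_integrable: "continuous_on {0..T} f \<Longrightarrow> integrable M f"
  for f :: "real \<Rightarrow> 'a::euclidean_space"
  unfolding set_integrable_iff[symmetric] by (rule borel_integrable_atLeastAtMost')

lemma continuous_Icc_measurable: "continuous_on {0..T} f \<Longrightarrow> f \<in> borel_measurable M"
  for f :: "real \<Rightarrow> 'a::euclidean_space"
  using continuous_Icc_integrable by (rule borel_measurable_integrable)

lemma Parseval_le:
  assumes cont: "continuous_on UNIV f" and per: "f 0 = f T" and "e > 0"
  obtains N where "(\<integral>t. (f t)\<^sup>2 \<partial>M) \<le> (\<Sum>j\<le>N. (\<integral>t. harmonic j t * f t \<partial>M)\<^sup>2 / harmonic_norm j) + e"
proof -
  \<comment> \<open>A uniform error \<open>d\<close> over one period has square integral at most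
    \<open>d\<^sup>2 * T\<close>, which is to be \<open>e\<close>.\<close>
  define d where "d = sqrt (e / T)"
  have d: "d > 0" "d\<^sup>2 * T = e"
    using \<open>e > 0\<close> w_pos by (auto simp: d_def)
  obtain P where P: "trig_poly P" "\<And>t. t \<in> {0..T} \<Longrightarrow> \<bar>f t - P t\<bar> < d"
    using trig_approximation[of f d] continuous_on_subset[OF cont] per d(1) by blast
  obtain c N where PN: "P = (\<lambda>t. \<Sum>j\<le>N. c j * harmonic j t)"
    by (rule trig_polyE[OF P(1)])
  have "(\<integral>t. (f t)\<^sup>2 \<partial>M) - (\<Sum>j\<le>N. (\<integral>t. harmonic j t * f t \<partial>M)\<^sup>2 / harmonic_norm j)
      \<le> (\<integral>t. (f t - (\<Sum>j\<le>N. c j * harmonic j t))\<^sup>2 \<partial>M)"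
    by (rule best_approximation)
       (auto intro!: continuous_square_integrable continuous_harmonic cont harmonic_norm_pos
             simp: harmonic_orthogonal)
  also have "\<dots> = (\<integral>t. (f t - P t)\<^sup>2 \<partial>M)"
    by (simp add: PN)
  also have "\<dots> \<le> (\<integral>t. d\<^sup>2 \<partial>M)"
  proof (rule integral_mono_AE)
    show "integrable M (\<lambda>t. (f t - P t)\<^sup>2)"
      by (intro continuous_integrable continuous_intros cont trig_poly_continuous P)
    have "(f t - P t)\<^sup>2 \<le> d\<^sup>2" if "t \<in> {0..T}" for t
      using P(2)[OF that] by (simp add: abs_le_square_iff[symmetric])
    then show "AE t in M. (f t - P t)\<^sup>2 \<le> d\<^sup>2"
      by (intro AE_I2) (simp add: space_M)
  qed simp
  also have "\<dots> = e"
    using d(2) measure_M by (simp add: mult.commute)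
  finally show thesis by (intro that[of N]) linarith
qed

text \<open>Uniform approximation suffices for a merely integrable \<open>v\<close>: the error is at
  most \<open>e\<close> times the L1 norm of \<open>v\<close>.\<close>

lemma orthogonal_to_continuous:
  assumes v: "integrable M v" "\<And>j. (\<integral>t. harmonic j t * v t \<partial>M) = 0"
    and f: "continuous_on {0..T} f" "f 0 = f T"
  shows "(\<integral>t. f t * v t \<partial>M) = 0"
proof -
  have bounded_mult: "integrable M (\<lambda>t. g t * v t)" if "continuous_on {0..T} g" for g
  proof -
    have "compact (g ` {0..T})"
      using that by (rule compact_continuous_image) simp
    then obtain K where K: "\<And>t. t \<in> {0..T} \<Longrightarrow> \<bar>g t\<bar> \<le> K"
      by (meson compact_imp_bounded bounded_real imageI)
    show ?thesis
    proof (rule Bochner_Integration.integrable_bound)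
      show "integrable M (\<lambda>t. K * v t)" using v(1) by simp
      show "(\<lambda>t. g t * v t) \<in> borel_measurable M"
        using continuous_Icc_measurable[OF that] v(1) by measurable
      show "AE t in M. norm (g t * v t) \<le> norm (K * v t)"
      proof (rule AE_I2)
        fix t assume "t \<in> space M"
        then have "\<bar>g t\<bar> \<le> \<bar>K\<bar>" using K[of t] by (auto simp: space_M)
        then show "norm (g t * v t) \<le> norm (K * v t)"
          by (simp add: abs_mult mult_right_mono)
      qed
    qed
  qed
  have "\<bar>\<integral>t. f t * v t \<partial>M\<bar> \<le> e * (\<integral>t. \<bar>v t\<bar> \<partial>M)" if "e > 0" for e
  proof -
    obtain P where P: "trig_poly P" "\<And>t. t \<in> {0..T} \<Longrightarrow> \<bar>f t - P t\<bar> < e"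
      using trig_approximation[OF f \<open>e > 0\<close>] by blast
    obtain c N where PN: "P = (\<lambda>t. \<Sum>j\<le>N. c j * harmonic j t)"
      by (rule trig_polyE[OF P(1)])
    have "(\<integral>t. P t * v t \<partial>M) = (\<integral>t. (\<Sum>j\<le>N. c j * (harmonic j t * v t)) \<partial>M)"
      by (simp add: PN sum_distrib_right mult.assoc)
    also have "\<dots> = 0"
      by (subst Bochner_Integration.integral_sum) (auto intro!: bounded_mult continuous_harmonic simp: v(2))
    finally have "(\<integral>t. f t * v t \<partial>M) = (\<integral>t. (f t - P t) * v t \<partial>M)"
      using bounded_mult[OF f(1)] bounded_mult[OF trig_poly_continuous[OF P(1)]]
      by (simp add: left_diff_distrib)
    also have "\<bar>\<dots>\<bar> \<le> (\<integral>t. \<bar>(f t - P t) * v t\<bar> \<partial>M)"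
      by (rule integral_abs_bound)
    also have "\<dots> \<le> (\<integral>t. e * \<bar>v t\<bar> \<partial>M)"
    proof (rule integral_mono_AE)
      show "integrable M (\<lambda>t. \<bar>(f t - P t) * v t\<bar>)"
        by (intro integrable_abs bounded_mult continuous_intros f trig_poly_continuous P)
      show "AE t in M. \<bar>(f t - P t) * v t\<bar> \<le> e * \<bar>v t\<bar>"
        using P(2) by (intro AE_I2) (auto simp: abs_mult space_M less_imp_le intro!: mult_right_mono)
    qed (use v(1) in simp)
    finally show ?thesis by simp
  qed
  note bound = this
  show ?thesis
  proof (rule ccontr)
    let ?K = "\<integral>t. \<bar>v t\<bar> \<partial>M" and ?I = "\<bar>\<integral>t. f t * v t \<partial>M\<bar>"
    assume "(\<integral>t. f t * v t \<partial>M) \<noteq> 0"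
    then have I: "?I > 0" by simp
    have K: "?K \<ge> 0" by simp
    have K1: "?K + 1 > 0" using K by linarith
    \<comment> \<open>The choice of \<open>e\<close> forces
      \<open>?I * (?K + 1) \<le> ?I * ?K\<close>; the summand 1 also keeps the denominator
      positive.\<close>
    have "?I \<le> ?I / (?K + 1) * ?K"
      by (rule bound) (use I K1 in simp)
    then have "?I * (?K + 1) \<le> ?I * ?K"
      using K1 by (simp only: times_divide_eq_left pos_le_divide_eq)
    then show False using I by (simp add: algebra_simps)
  qed
qed

text \<open>The sign of \<open>v\<close> is an almost everywhere limit of continuous functions; truncated to
  \<open>{-1..1}\<close> and cut off near the end points, these become admissible test functions.\<close>

lemma AE_zero_if_orthogonal_to_harmonics:
  assumes v: "integrable M v" "\<And>j. (\<integral>t. harmonic j t * v t \<partial>M) = 0"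
  shows "AE t in M. v t = 0"
proof -
  have "v \<in> borel_measurable M" using v(1) by simp
  then have "(\<lambda>t. indicator {0..T} t *\<^sub>R v t) \<in> borel_measurable lborel"
    by (subst (asm) borel_measurable_restrict_space_iff) auto
  \<comment> \<open>Tested against its own sign, \<open>v\<close> yields its L1 norm; a bounded test
    function can be approximated under domination by the absolute value of \<open>v\<close>.\<close>
  then have "(\<lambda>t. sgn (indicator {0..T} t *\<^sub>R v t)) \<in> borel_measurable lborel"
    by measurable
  then have "(\<lambda>t. sgn (indicator {0..T} t *\<^sub>R v t)) \<in> borel_measurable lebesgue"
    by (rule measurable_completion)
  then have "(\<lambda>t. sgn (indicator {0..T} t *\<^sub>R v t)) measurable_on UNIV"
    by (subst measurable_on_iff_borel_measurable) auto
  then obtain N g where N: "negligible N" and cont: "\<And>n. continuous_on UNIV (g n)"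
    and lim: "\<And>t. t \<notin> N \<Longrightarrow> (\<lambda>n. g n t) \<longlonglongrightarrow> sgn (indicator {0..T} t *\<^sub>R v t)"
    unfolding measurable_on_def by auto
  define f where "f n t = max (-1) (min 1 (g n t)) * min 1 (real n * (t * (T - t)))" for n t
  have f: "continuous_on {0..T} (f n)" "f n 0 = f n T" for n
    unfolding f_def by (auto intro!: continuous_intros continuous_on_subset[OF cont])
  have f_le: "\<bar>f n t\<bar> \<le> 1" if "t \<in> {0..T}" for n t
  proof -
    have "0 \<le> real n * (t * (T - t))" using that by auto
    then have "\<bar>min 1 (real n * (t * (T - t)))\<bar> \<le> 1" by linarith
    moreover have "\<bar>max (-1) (min 1 (g n t))\<bar> \<le> 1" by linarith
    ultimately show ?thesis unfolding f_def abs_mult by (intro mult_le_one) auto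
  qed
  have f_lim: "(\<lambda>n. f n t) \<longlonglongrightarrow> sgn (v t)" if t: "t \<in> {0..T}" "t \<notin> N \<union> {0, T}" for t
  proof -
    have "t * (T - t) > 0" using t by auto
    then have "filterlim (\<lambda>n. real n * (t * (T - t))) at_top sequentially"
      using filterlim_real_sequentially by (rule filterlim_at_top_mult_tendsto_pos[OF tendsto_const])
    then have "eventually (\<lambda>n. real n * (t * (T - t)) \<ge> 1) sequentially"
      by (simp add: filterlim_at_top)
    then have "eventually (\<lambda>n. min 1 (real n * (t * (T - t))) = 1) sequentially"
      by eventually_elim simp
    then have A: "(\<lambda>n. min 1 (real n * (t * (T - t)))) \<longlonglongrightarrow> 1"
      by (rule tendsto_eventually)
    have "(\<lambda>n. max (-1) (min 1 (g n t))) \<longlonglongrightarrow> max (-1) (min 1 (sgn (v t)))"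
      using lim[of t] t by (intro tendsto_intros) auto
    also have "max (-1) (min 1 (sgn (v t))) = sgn (v t)"
      by (simp add: sgn_if)
    finally show ?thesis
      using tendsto_mult[OF _ A] unfolding f_def by fastforce
  qed
  have "(\<lambda>n. \<integral>t. f n t * v t \<partial>M) \<longlonglongrightarrow> (\<integral>t. sgn (v t) * v t \<partial>M)"
  proof (rule integral_dominated_convergence)
    show "(\<lambda>t. sgn (v t) * v t) \<in> borel_measurable M" using v(1) by measurable
    show "(\<lambda>t. f n t * v t) \<in> borel_measurable M" for n
      using continuous_Icc_measurable[OF f(1)] v(1) by measurable
    show "integrable M (\<lambda>t. \<bar>v t\<bar>)" using v(1) by simp
    show "AE t in M. norm (f n t * v t) \<le> \<bar>v t\<bar>" for n
      using f_le by (intro AE_I2) (auto simp: abs_mult space_M intro: mult_left_le_one_le)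
    \<comment> \<open>The end points join the exceptional set because the cut-off vanishes there for
      every \<open>n\<close>.\<close>
    have "negligible (N \<union> {0, T})" using N by simp
    then have "AE t in lebesgue. t \<notin> N \<union> {0, T}"
      unfolding negligible_iff_null_sets by (rule AE_not_in)
    then have "AE t in lborel. t \<notin> N \<union> {0, T}"
      by (simp add: AE_completion_iff)
    then have "AE t in lborel. t \<in> {0..T} \<longrightarrow> (\<lambda>n. f n t * v t) \<longlonglongrightarrow> sgn (v t) * v t"
      by eventually_elim (intro impI tendsto_intros f_lim)
    then show "AE t in M. (\<lambda>n. f n t * v t) \<longlonglongrightarrow> sgn (v t) * v t"
      by (subst AE_restrict_space_iff) auto
  qed
  moreover have "(\<integral>t. f n t * v t \<partial>M) = 0" for n
    using v f by (rule orthogonal_to_continuous)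
  ultimately have "(\<integral>t. sgn (v t) * v t \<partial>M) = 0"
    by (simp add: LIMSEQ_const_iff)
  then have "(\<integral>t. \<bar>v t\<bar> \<partial>M) = 0"
    by (simp add: abs_sgn mult.commute)
  then show ?thesis
    using v(1) by (subst (asm) integral_nonneg_eq_0_iff_AE) auto
qed

text \<open>The weak relation turns each Bessel term of \<open>g\<close> into (w freq)^2 times the
  Parseval term of \<open>f\<close>. Subtracting the mean removes index 0, the vanishing
  coefficients remove the frequencies up to \<open>k\<close>, and every remaining factor is at least
  (w (k + 1))^2.\<close>

lemma Wirtinger_inequality:
  assumes f: "continuous_on UNIV f" "f 0 = f T" and g: "square_integrable M g"
    and weak: "\<And>j. (\<integral>t. harmonic' j t * g t \<partial>M) = (w * freq j)\<^sup>2 * (\<integral>t. harmonic j t * f t \<partial>M)"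
    and zero: "\<And>j. j \<in> {1..2 * k} \<Longrightarrow> (\<integral>t. harmonic j t * f t \<partial>M) = 0"
  shows "(w * (real k + 1))\<^sup>2 * ((\<integral>t. (f t)\<^sup>2 \<partial>M) - (\<integral>t. f t \<partial>M)\<^sup>2 / T) \<le> (\<integral>t. (g t)\<^sup>2 \<partial>M)"
proof -
  let ?A = "\<lambda>j. (\<integral>t. harmonic j t * f t \<partial>M)\<^sup>2 / harmonic_norm j"
  let ?C = "(w * (real k + 1))\<^sup>2"
  have C: "?C > 0" using w_pos by simp
  \<comment> \<open>The sum starts at 1: Bessel asks for positive norms, and
    \<open>harmonic' 0\<close> is zero.\<close>
  have partial: "?C * (\<Sum>j\<in>{1..N}. ?A j) \<le> (\<integral>t. (g t)\<^sup>2 \<partial>M)" for N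
  proof -
    have "?C * (\<Sum>j\<in>{1..N}. ?A j) \<le> (\<Sum>j\<in>{1..N}. (\<integral>t. harmonic' j t * g t \<partial>M)\<^sup>2 / ((w * freq j)\<^sup>2 * harmonic_norm j))"
      unfolding sum_distrib_left
    proof (rule sum_mono)
      fix j assume j: "j \<in> {1..N}"
      then have nz: "w * freq j \<noteq> 0" using w_pos by (simp add: freq_eq_0_iff)
      have "?C * ?A j \<le> (w * freq j)\<^sup>2 * ?A j"
      proof (cases "j \<le> 2 * k")
        case True
        then show ?thesis using zero[of j] j by simp
      next
        case False
        then have "real k + 1 \<le> freq j"
          using freq_le_iff[of j k] by simp
        then have "w * (real k + 1) \<le> w * freq j" using w_pos by simp
        then have "?C \<le> (w * freq j)\<^sup>2" using w_pos by (intro power_mono) auto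
        then show ?thesis
          using harmonic_norm_pos[of j] by (intro mult_right_mono) auto
      qed
      also have "\<dots> = (\<integral>t. harmonic' j t * g t \<partial>M)\<^sup>2 / ((w * freq j)\<^sup>2 * harmonic_norm j)"
        using nz unfolding weak by (simp add: power2_eq_square)
      finally show "?C * ?A j \<le> (\<integral>t. harmonic' j t * g t \<partial>M)\<^sup>2 / ((w * freq j)\<^sup>2 * harmonic_norm j)" .
    qed
    also have "\<dots> \<le> (\<integral>t. (g t)\<^sup>2 \<partial>M)"
      by (rule Bessel_inequality)
         (use g w_pos in \<open>auto intro!: continuous_square_integrable continuous_harmonic' mult_pos_pos harmonic_norm_pos
             simp: harmonic'_orthogonal freq_eq_0_iff\<close>)
    finally show ?thesis .
  qed
  show ?thesis
  proof (rule field_le_epsilon)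
    fix e :: real assume "e > 0"
    then have "e / ?C > 0" using C by simp
    then obtain N where N: "(\<integral>t. (f t)\<^sup>2 \<partial>M) \<le> (\<Sum>j\<le>N. ?A j) + e / ?C"
      using Parseval_le[OF f] by blast
    have "(\<Sum>j\<le>N. ?A j) = ?A 0 + (\<Sum>j\<in>{1..N}. ?A j)"
      by (simp add: atMost_atLeast0 sum.atLeast_Suc_atMost)
    then have "(\<integral>t. (f t)\<^sup>2 \<partial>M) - (\<integral>t. f t \<partial>M)\<^sup>2 / T \<le> (\<Sum>j\<in>{1..N}. ?A j) + e / ?C"
      using N by (simp add: harmonic_norm_def)
    then have "?C * ((\<integral>t. (f t)\<^sup>2 \<partial>M) - (\<integral>t. f t \<partial>M)\<^sup>2 / T) \<le> ?C * ((\<Sum>j\<in>{1..N}. ?A j) + e / ?C)"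
      using C by (intro mult_left_mono) auto
    also have "\<dots> = ?C * (\<Sum>j\<in>{1..N}. ?A j) + e"
      using C by (simp add: distrib_left)
    also have "\<dots> \<le> (\<integral>t. (g t)\<^sup>2 \<partial>M) + e"
      using partial by simp
    finally show "(w * (real k + 1))\<^sup>2 * ((\<integral>t. (f t)\<^sup>2 \<partial>M) - (\<integral>t. f t \<partial>M)\<^sup>2 / T) \<le> (\<integral>t. (g t)\<^sup>2 \<partial>M) + e"
      by simp
  qed
qed

end

section \<open>Weak derivatives of periodic loops\<close>

lemma smooth_on_UNIV_has_derivative:
  assumes "smooth_on UNIV f"
  shows "(f has_real_derivative deriv f t) (at t)" "continuous_on UNIV f" "continuous_on UNIV (deriv f)"
proof -
  have "f field_differentiable at t" for t
    using assms unfolding smooth_on_def by (auto dest: spec[of _ 0])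
  then show D: "(f has_real_derivative deriv f t) (at t)" for t
    by (simp add: DERIV_deriv_iff_field_differentiable)
  show "continuous_on UNIV f"
    using D by (meson DERIV_isCont continuous_at_imp_continuous_on)
  have "deriv f field_differentiable at t" for t
    using assms unfolding smooth_on_def by (auto dest: spec[of _ 1])
  then show "continuous_on UNIV (deriv f)"
    by (simp add: continuous_at_imp_continuous_on field_differentiable_imp_continuous_at)
qed

lemma apply_bcontfun_sum:
  fixes u :: "'i \<Rightarrow> ('a::topological_space \<Rightarrow>\<^sub>C 'b::real_normed_vector)"
  shows "apply_bcontfun (\<Sum>j\<in>J. u j) t = (\<Sum>j\<in>J. apply_bcontfun (u j) t)"
  by (induction J rule: infinite_finite_induct) auto

text \<open>Brings pairs into a shape to which the rules for continuity and derivatives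
  apply.\<close>

lemma vector_2_eq_scaleR_sum: "vector [r, s] = r *\<^sub>R axis 1 1 + s *\<^sub>R axis (2::2) (1::real)"
  by (simp add: vec_eq_iff forall_2 axis_def)

context loop_period
begin

text \<open>The factor \<open>r\<close> closes the induction: every derivative is again a multiple
  of a wave of the same frequency.\<close>

lemma smooth_wave: "smooth_on UNIV (\<lambda>t. r * wave n \<alpha> t)"
proof -
  have "\<exists>r' \<alpha>'. (deriv ^^ m) (\<lambda>t. r * wave n \<alpha> t) = (\<lambda>t. r' * wave n \<alpha>' t)" for m
  proof (induction m arbitrary: r \<alpha>)
    case (Suc m)
    have "deriv (\<lambda>t. r * wave n \<alpha> t) = (\<lambda>t. (r * (w * n)) * wave n (\<alpha> - pi / 2) t)"
      by (intro ext DERIV_imp_deriv) (auto intro!: derivative_eq_intros wave_deriv)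
    then show ?case using Suc by (simp only: funpow_Suc_right o_apply)
  qed auto
  moreover have "(\<lambda>t. r * wave n \<alpha> t) field_differentiable at t" for r \<alpha> t
    by (intro derivative_intros field_differentiable_mult) (auto simp: field_differentiable_def intro: wave_deriv)
  ultimately show ?thesis
    unfolding smooth_on_def by metis
qed

lemma smooth_harmonic: "smooth_on UNIV (harmonic j)"
  using smooth_wave[of 1] by (simp add: harmonic_def)

lemma smooth_harmonic': "smooth_on UNIV (harmonic' j)"
  unfolding harmonic'_def[abs_def] by (rule smooth_wave)

lemma deriv_harmonic: "deriv (harmonic j) = harmonic' j"
  by (intro ext DERIV_imp_deriv harmonic_deriv)

lemma deriv_harmonic': "deriv (harmonic' j) = (\<lambda>t. - (w * freq j)\<^sup>2 * harmonic j t)"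
  by (intro ext DERIV_imp_deriv harmonic'_deriv)

lemma harmonic'_0 [simp]: "harmonic' 0 t = 0"
  by (simp add: harmonic'_def)

lemma L2_per_square_integrable:
  assumes "v \<in> L2_per T"
  shows "square_integrable M (\<lambda>t. v t $ i)"
proof -
  have v: "v \<in> borel_measurable M" "integrable M (\<lambda>t. (norm (v t))\<^sup>2)"
    using assms by (auto simp: L2_per_def set_integrable_iff intro: borel_measurable_M)
  have m: "(\<lambda>t. v t $ i) \<in> borel_measurable M"
    using v(1) by (rule measurable_compose) (intro borel_measurable_continuous_onI continuous_intros)
  moreover have "integrable M (\<lambda>t. (v t $ i)\<^sup>2)"
  proof (rule Bochner_Integration.integrable_bound[OF v(2)])
    show "(\<lambda>t. (v t $ i)\<^sup>2) \<in> borel_measurable M" using m by measurable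
    show "AE t in M. norm ((v t $ i)\<^sup>2) \<le> norm ((norm (v t))\<^sup>2)"
      by (intro AE_I2) (simp add: abs_le_square_iff[symmetric] component_le_norm_cart)
  qed
  ultimately show ?thesis by (simp add: square_integrable_def)
qed

text \<open>Integrability is what permits splitting, and taking components of, the vector-valued
  integrals that define a weak derivative.\<close>

lemma L2_per_test_integrable:
  assumes v: "v \<in> L2_per T" and \<phi>: "continuous_on UNIV \<phi>"
  shows "integrable M (\<lambda>t. \<phi> t *\<^sub>R v t)"
proof (rule Bochner_Integration.integrable_bound)
  show "integrable M (\<lambda>t. (\<phi> t)\<^sup>2 + (norm (v t))\<^sup>2)"
    using v continuous_square_integrable[OF \<phi>]
    by (auto simp: L2_per_def set_integrable_iff square_integrable_def)
  show "(\<lambda>t. \<phi> t *\<^sub>R v t) \<in> borel_measurable M"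
    using v by (intro borel_measurable_M borel_measurable_scaleR borel_measurable_continuous_onI[OF \<phi>])
      (auto simp: L2_per_def)
  have "\<bar>r\<bar> * s \<le> r\<^sup>2 + s\<^sup>2" if "s \<ge> 0" for r s :: real
  proof -
    have "2 * (\<bar>r\<bar> * s) \<le> r\<^sup>2 + s\<^sup>2"
      using sum_squares_bound[of "\<bar>r\<bar>" s] by simp
    moreover have "0 \<le> \<bar>r\<bar> * s" using that by simp
    ultimately show ?thesis by linarith
  qed
  then show "AE t in M. norm (\<phi> t *\<^sub>R v t) \<le> norm ((\<phi> t)\<^sup>2 + (norm (v t))\<^sup>2)"
    by auto
qed

lemma continuous_periodic_L2_per:
  assumes "continuous_on UNIV u" "\<And>t. u (t + T) = u t"
  shows "u \<in> L2_per T"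
  using assms unfolding L2_per_def set_integrable_iff
  by (auto intro!: borel_measurable_continuous_onI continuous_integrable continuous_intros)

lemma weak_derivative_component:
  assumes "u \<in> L2_per T" "v \<in> L2_per T" "is_weak_derivative T u v"
    and \<phi>: "smooth_on UNIV \<phi>" "\<And>t. \<phi> (t + T) = \<phi> t"
  shows "(\<integral>t. deriv \<phi> t * u t $ i \<partial>M) = - (\<integral>t. \<phi> t * v t $ i \<partial>M)"
proof -
  note bl = bounded_linear_vec_nth[of i]
  have "(\<integral>t. deriv \<phi> t *\<^sub>R u t \<partial>M) = - (\<integral>t. \<phi> t *\<^sub>R v t \<partial>M)"
    using assms unfolding is_weak_derivative_def set_integral_eq by blast
  then have "(\<integral>t. deriv \<phi> t *\<^sub>R u t \<partial>M) $ i = - ((\<integral>t. \<phi> t *\<^sub>R v t \<partial>M) $ i)"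
    by simp
  also have "(\<integral>t. deriv \<phi> t *\<^sub>R u t \<partial>M) $ i = (\<integral>t. (deriv \<phi> t *\<^sub>R u t) $ i \<partial>M)"
    using L2_per_test_integrable[OF assms(1) smooth_on_UNIV_has_derivative(3)[OF \<phi>(1)]]
    by (rule integral_bounded_linear[OF bl, symmetric])
  also have "(\<integral>t. \<phi> t *\<^sub>R v t \<partial>M) $ i = (\<integral>t. (\<phi> t *\<^sub>R v t) $ i \<partial>M)"
    using L2_per_test_integrable[OF assms(2) smooth_on_UNIV_has_derivative(2)[OF \<phi>(1)]]
    by (rule integral_bounded_linear[OF bl, symmetric])
  finally show ?thesis by simp
qed

lemma weak_derivative_spec:
  assumes "u \<in> W12_per T"
  shows "weak_derivative T u \<in> L2_per T" "is_weak_derivative T (apply_bcontfun u) (weak_derivative T u)"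
proof -
  have "\<exists>v. v \<in> L2_per T \<and> is_weak_derivative T (apply_bcontfun u) v"
    using assms by (auto simp: W12_per_def)
  from someI_ex[OF this]
  show "weak_derivative T u \<in> L2_per T" "is_weak_derivative T (apply_bcontfun u) (weak_derivative T u)"
    unfolding weak_derivative_def by blast+
qed

lemma W12_per_L2_per: "u \<in> W12_per T \<Longrightarrow> apply_bcontfun u \<in> L2_per T"
  by (simp add: W12_per_def)

text \<open>The test function \<open>harmonic' j\<close> has derivative - (w freq j)^2
  \<open>harmonic j\<close>; testing with the constant \<open>harmonic 0\<close> gives the vanishing
  mean.\<close>

lemma W12_per_harmonic:
  assumes "u \<in> W12_per T"
  shows "(\<integral>t. harmonic' j t * weak_derivative T u t $ i \<partial>M)
      = (w * freq j)\<^sup>2 * (\<integral>t. harmonic j t * u t $ i \<partial>M)"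
    and "(\<integral>t. weak_derivative T u t $ i \<partial>M) = 0"
proof -
  note comp = weak_derivative_component[OF W12_per_L2_per[OF assms] weak_derivative_spec[OF assms], of _ i]
  show "(\<integral>t. harmonic' j t * weak_derivative T u t $ i \<partial>M)
      = (w * freq j)\<^sup>2 * (\<integral>t. harmonic j t * u t $ i \<partial>M)"
    using comp[OF smooth_harmonic' harmonic'_periodic, of j]
    by (simp add: deriv_harmonic' mult.assoc)
  show "(\<integral>t. weak_derivative T u t $ i \<partial>M) = 0"
    using comp[OF smooth_harmonic harmonic_periodic, of 0]
    by (simp add: deriv_harmonic)
qed

text \<open>Integration by parts over a period has no boundary term, so \<open>u'\<close> is a weak
  derivative. The chosen one has the same integrals against all harmonics, hence agrees with it
  almost everywhere.\<close>

lemma C1_weak_derivative: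
  fixes u :: "real \<Rightarrow>\<^sub>C (real^2)"
  assumes deriv: "\<And>t. (apply_bcontfun u has_vector_derivative u' t) (at t)"
    and cont: "continuous_on UNIV u'"
    and per: "\<And>t. u (t + T) = u t" "\<And>t. u' (t + T) = u' t"
  shows "u \<in> W12_per T" "AE t in M. weak_derivative T u t = u' t"
proof -
  have u: "apply_bcontfun u \<in> L2_per T" and u': "u' \<in> L2_per T"
    using cont per by (auto intro!: continuous_periodic_L2_per)
  have weak: "is_weak_derivative T u u'"
    unfolding is_weak_derivative_def set_integral_eq
  proof (intro allI impI)
    fix \<phi> assume "smooth_on UNIV \<phi> \<and> (\<forall>t. \<phi> (t + T) = \<phi> t)"
    then have \<phi>: "smooth_on UNIV \<phi>" "\<And>t. \<phi> (t + T) = \<phi> t" by auto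
    note D = smooth_on_UNIV_has_derivative[OF \<phi>(1)]
    have "(\<integral>t. \<phi> t *\<^sub>R u' t + deriv \<phi> t *\<^sub>R u t \<partial>M) = \<phi> T *\<^sub>R u T - \<phi> 0 *\<^sub>R u 0"
      by (rule integral_derivative)
         (auto intro!: has_vector_derivative_scaleR D deriv continuous_intros cont)
    also have "\<dots> = 0"
      using per(1)[of 0] \<phi>(2)[of 0] by simp
    finally have "(\<integral>t. \<phi> t *\<^sub>R u' t \<partial>M) + (\<integral>t. deriv \<phi> t *\<^sub>R u t \<partial>M) = 0"
      using L2_per_test_integrable[OF u D(3)] L2_per_test_integrable[OF u' D(2)] by simp
    then show "(\<integral>t. deriv \<phi> t *\<^sub>R u t \<partial>M) = - (\<integral>t. \<phi> t *\<^sub>R u' t \<partial>M)"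
      by (simp add: eq_neg_iff_add_eq_0 add.commute)
  qed
  show W: "u \<in> W12_per T"
    using u u' weak by (auto simp: W12_per_def)
  let ?v = "weak_derivative T u"
  have "AE t in M. ?v t $ i - u' t $ i = 0" for i
  proof (rule AE_zero_if_orthogonal_to_harmonics)
    have sq: "square_integrable M (\<lambda>t. ?v t $ i)" "square_integrable M (\<lambda>t. u' t $ i)"
      using weak_derivative_spec(1)[OF W] u' by (auto intro: L2_per_square_integrable)
    show "integrable M (\<lambda>t. ?v t $ i - u' t $ i)"
      using sq by (intro Bochner_Integration.integrable_diff square_integrable_integrable)
    fix j
    note h = continuous_square_integrable[OF continuous_harmonic[of _ j]]
    have "(\<integral>t. harmonic j t * ?v t $ i \<partial>M) = (\<integral>t. harmonic j t * u' t $ i \<partial>M)"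
      using weak_derivative_component[OF u weak_derivative_spec[OF W] smooth_harmonic harmonic_periodic, of j i]
        weak_derivative_component[OF u u' weak smooth_harmonic harmonic_periodic, of j i]
      by simp
    then show "(\<integral>t. harmonic j t * (?v t $ i - u' t $ i) \<partial>M) = 0"
      using square_integrable_mult[OF h sq(1)] square_integrable_mult[OF h sq(2)]
      by (simp add: right_diff_distrib)
  qed
  from this[of 1] this[of 2] show "AE t in M. ?v t = u' t"
    by eventually_elim (simp add: vec_eq_iff forall_2)
qed

text \<open>Only the first component is recorded: the second enters the form through a square whose
  mean is already fixed by the first.\<close>

definition harmonic_coeff :: "nat \<Rightarrow> (real \<Rightarrow>\<^sub>C (real^2)) \<Rightarrow> real" where
  "harmonic_coeff j u = (\<integral>t. harmonic j t * u t $ 1 \<partial>M)"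

lemma linear_harmonic_coeff: "linear (harmonic_coeff j)"
proof -
  have "integrable M (\<lambda>t. harmonic j t * apply_bcontfun u t $ 1)" for u :: "real \<Rightarrow>\<^sub>C (real^2)"
    by (intro continuous_integrable continuous_intros continuous_harmonic continuous_on_apply_bcontfun)
  then show ?thesis
    unfolding harmonic_coeff_def by (intro linearI) (simp_all add: distrib_left mult.left_commute)
qed

end

section \<open>The diagonal quadratic form\<close>

text \<open>In the coordinates \<open>(u\<^sub>1, u\<^sub>2' + b u\<^sub>1)\<close> the quadratic form is diagonal on the harmonics of
  \<open>u\<^sub>1\<close>, except that \<open>u\<^sub>2' + b u\<^sub>1\<close> and \<open>b u\<^sub>1\<close> always have the same mean.\<close>

locale radial_form = loop_period +
  fixes p\<^sub>0 \<eta> b d :: real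
  assumes p\<^sub>0_pos: "p\<^sub>0 > 0" and \<eta>_pos: "\<eta> > 0"
begin

definition form :: "(real \<Rightarrow>\<^sub>C (real^2)) \<Rightarrow> real" where
  "form u = (\<integral>t. p\<^sub>0 * (weak_derivative T u t $ 1)\<^sup>2 + d * (u t $ 1)\<^sup>2
      + \<eta> * (weak_derivative T u t $ 2 + b * u t $ 1)\<^sup>2 \<partial>M)"

text \<open>Split \<open>u1\<close> into its mean and the rest. Wirtinger controls the rest with
  factor \<open>p\<^sub>0 * ?C + d\<close>. The completed square contributes at least the square of
  its mean \<open>b * ?m\<close>, which gives the constants the factor
  \<open>d + \<eta> * b\<^sup>2\<close>; if this is negative, the mean vanishes by
  assumption.\<close>

lemma form_nonneg:
  assumes u: "u \<in> W12_per T" and zero: "\<And>j. j \<in> {1..2 * k} \<Longrightarrow> harmonic_coeff j u = 0"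
    and k: "p\<^sub>0 * (w * (real k + 1))\<^sup>2 + d \<ge> 0"
    and mean: "d + \<eta> * b\<^sup>2 < 0 \<Longrightarrow> harmonic_coeff 0 u = 0"
  shows "form u \<ge> 0"
proof -
  let ?v = "weak_derivative T u" and ?m = "harmonic_coeff 0 u"
  let ?u1 = "\<lambda>t. u t $ 1"
  let ?C = "(w * (real k + 1))\<^sup>2"
  let ?X = "(\<integral>t. (?u1 t)\<^sup>2 \<partial>M) - ?m\<^sup>2 / T"
  let ?Y = "\<lambda>t. ?v t $ 2 + b * ?u1 t"
  have v: "square_integrable M (\<lambda>t. ?v t $ i)" for i
    using weak_derivative_spec(1)[OF u] by (rule L2_per_square_integrable)
  have cont: "continuous_on UNIV ?u1"
    by (intro continuous_intros continuous_on_apply_bcontfun)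
  then have u1: "square_integrable M ?u1"
    by (rule continuous_square_integrable)
  have Y: "square_integrable M ?Y"
    by (intro square_integrable_add square_integrable_cmult v u1)
  have m: "?m = (\<integral>t. ?u1 t \<partial>M)"
    by (simp add: harmonic_coeff_def)
  have mean_le: "(\<integral>t. f t \<partial>M)\<^sup>2 / T \<le> (\<integral>t. (f t)\<^sup>2 \<partial>M)" if "square_integrable M f" for f
  proof -
    \<comment> \<open>Bessel for the constant harmonic alone is the Cauchy-Schwarz bound for the
      mean.\<close>
    have "(\<Sum>j\<in>{0}. (\<integral>t. harmonic j t * f t \<partial>M)\<^sup>2 / harmonic_norm j) \<le> (\<integral>t. (f t)\<^sup>2 \<partial>M)"
      by (rule Bessel_inequality[OF _ that _ harmonic_orthogonal harmonic_norm_pos])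
         (auto intro: continuous_square_integrable continuous_harmonic)
    then show ?thesis by (simp add: harmonic_norm_def)
  qed
  have per: "?u1 0 = ?u1 T"
    using W12_per_L2_per[OF u] by (auto simp: L2_per_def dest!: spec[of _ 0])
  have v1: "?C * ?X \<le> (\<integral>t. (?v t $ 1)\<^sup>2 \<partial>M)"
    unfolding m
    by (rule Wirtinger_inequality[OF cont per v W12_per_harmonic(1)[OF u]])
       (use zero in \<open>simp add: harmonic_coeff_def\<close>)
  have "(\<integral>t. ?Y t \<partial>M) = b * ?m"
    using v[THEN square_integrable_integrable] u1[THEN square_integrable_integrable]
      W12_per_harmonic(2)[OF u] by (simp add: m)
  then have Y_ge: "b\<^sup>2 * (?m\<^sup>2 / T) \<le> (\<integral>t. (?Y t)\<^sup>2 \<partial>M)"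
    using mean_le[OF Y] by (simp add: power_mult_distrib)
  have "?X \<ge> 0" using mean_le[OF u1] by (simp add: m)
  then have "0 \<le> (p\<^sub>0 * ?C + d) * ?X" using k by simp
  moreover have "0 \<le> (d + \<eta> * b\<^sup>2) * (?m\<^sup>2 / T)"
  proof (cases "d + \<eta> * b\<^sup>2 < 0")
    case True
    then show ?thesis using mean by simp
  next
    case False
    then show ?thesis using T_pos by (intro mult_nonneg_nonneg divide_nonneg_pos) auto
  qed
  \<comment> \<open>\<open>Z\<close> stands for the integral of \<open>u1\<close> squared and
    \<open>R\<close> for its constant part \<open>?m\<^sup>2 / T\<close>.\<close>
  moreover have "(p\<^sub>0 * C + d) * (Z - R) + (d + \<eta> * b\<^sup>2) * R = p\<^sub>0 * (C * (Z - R)) + d * Z + \<eta> * (b\<^sup>2 * R)" for C Z R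
    by algebra
  ultimately have "0 \<le> p\<^sub>0 * (?C * ?X) + d * (\<integral>t. (?u1 t)\<^sup>2 \<partial>M) + \<eta> * (b\<^sup>2 * (?m\<^sup>2 / T))"
    by (metis add_nonneg_nonneg)
  also have "\<dots> \<le> p\<^sub>0 * (\<integral>t. (?v t $ 1)\<^sup>2 \<partial>M) + d * (\<integral>t. (?u1 t)\<^sup>2 \<partial>M) + \<eta> * (\<integral>t. (?Y t)\<^sup>2 \<partial>M)"
    using v1 Y_ge p\<^sub>0_pos \<eta>_pos by (intro order_refl add_mono mult_left_mono) auto
  also have "\<dots> = form u"
    using v[of 1] u1 Y by (simp add: form_def square_integrable_def)
  finally show ?thesis .
qed

section \<open>Explicit trigonometric loops and the exact index\<close>

text \<open>The second component is chosen such that its derivative cancels \<open>b\<close> times the first one;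
  for \<open>j = 0\<close> both the numerator and \<open>1 / 0\<close> vanish.\<close>

definition mode :: "nat \<Rightarrow> real \<Rightarrow> real^2" where
  "mode j t = vector [harmonic j t, b / (w * freq j)\<^sup>2 * harmonic' j t]"

text \<open>Mode 0 is the constant loop (1, 0): the derivative of a periodic second component has
  mean zero and cannot cancel the constant \<open>b\<close>.\<close>

definition mode' :: "nat \<Rightarrow> real \<Rightarrow> real^2" where
  "mode' j t = vector [harmonic' j t, (if j = 0 then 0 else - b) * harmonic j t]"

lemma mode_bcontfun: "mode j \<in> bcontfun"
proof (rule bcontfun_normI)
  show "continuous_on UNIV (mode j)"
    unfolding mode_def[abs_def] vector_2_eq_scaleR_sum
    by (intro continuous_intros continuous_harmonic continuous_harmonic')
  fix t
  have "norm (mode j t) \<le> \<bar>harmonic j t\<bar> + \<bar>b / (w * freq j)\<^sup>2 * harmonic' j t\<bar>"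
    unfolding mode_def vector_2_eq_scaleR_sum by (rule norm_triangle_le) simp
  also have "\<dots> \<le> 1 + \<bar>b / (w * freq j)\<^sup>2 * (w * freq j)\<bar>"
    unfolding harmonic_def harmonic'_def wave_def abs_mult
    by (intro add_mono mult_left_mono) (auto intro: mult_left_le simp: abs_mult)
  finally show "norm (mode j t) \<le> 1 + \<bar>b / (w * freq j)\<^sup>2 * (w * freq j)\<bar>" .
qed

definition mode_loop :: "nat \<Rightarrow> (real \<Rightarrow>\<^sub>C (real^2))" where
  "mode_loop j = Bcontfun (mode j)"

lemma apply_mode_loop: "apply_bcontfun (mode_loop j) = mode j"
  unfolding mode_loop_def by (rule Bcontfun_inverse[OF mode_bcontfun])

lemma mode_deriv: "(mode j has_vector_derivative mode' j t) (at t)"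
proof -
  \<comment> \<open>The second derivative of a harmonic cancels the denominator; at
    \<open>j = 0\<close> both sides are 0 because division by zero yields 0.\<close>
  have "b / (w * freq j)\<^sup>2 * (- (w * freq j)\<^sup>2 * harmonic j t) = (if j = 0 then 0 else - b) * harmonic j t"
    using w_pos by (simp add: freq_eq_0_iff)
  then have "((\<lambda>t. b / (w * freq j)\<^sup>2 * harmonic' j t) has_real_derivative (if j = 0 then 0 else - b) * harmonic j t) (at t)"
    using DERIV_cmult[OF harmonic'_deriv, of "b / (w * freq j)\<^sup>2"] by metis
  then show ?thesis
    unfolding mode_def[abs_def] mode'_def vector_2_eq_scaleR_sum
    using harmonic_deriv[of j t] unfolding has_real_derivative_iff_has_vector_derivative
    by (intro has_vector_derivative_add bounded_linear.has_vector_derivative[OF bounded_linear_scaleR_left])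
qed

text \<open>The whole combination is treated as one continuously differentiable loop, since
  \<open>weak_derivative\<close>, being a choice, is linear only up to null sets.\<close>

lemma mode_loop_sum:
  fixes c :: "nat \<Rightarrow> real" and J
  defines "u \<equiv> \<Sum>j\<in>J. c j *\<^sub>R mode_loop j"
  shows "u \<in> W12_per T" "AE t in M. weak_derivative T u t = (\<Sum>j\<in>J. c j *\<^sub>R mode' j t)"
    and "u t $ 1 = (\<Sum>j\<in>J. c j * harmonic j t)"
proof -
  have u: "apply_bcontfun u = (\<lambda>t. \<Sum>j\<in>J. c j *\<^sub>R mode j t)"
    unfolding u_def by (simp add: fun_eq_iff apply_bcontfun_sum apply_mode_loop)
  have "(apply_bcontfun u has_vector_derivative (\<Sum>j\<in>J. c j *\<^sub>R mode' j t)) (at t)" for t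
    unfolding u by (intro has_vector_derivative_sum)
      (auto intro!: derivative_eq_intros mode_deriv)
  moreover have "continuous_on UNIV (\<lambda>t. \<Sum>j\<in>J. c j *\<^sub>R mode' j t)"
    unfolding mode'_def vector_2_eq_scaleR_sum
    by (intro continuous_intros continuous_harmonic continuous_harmonic')
  moreover have "u (t + T) = u t" for t
    unfolding u mode_def by (simp only: harmonic_periodic harmonic'_periodic)
  moreover have "(\<Sum>j\<in>J. c j *\<^sub>R mode' j (t + T)) = (\<Sum>j\<in>J. c j *\<^sub>R mode' j t)" for t
    unfolding mode'_def by (simp only: harmonic_periodic harmonic'_periodic)
  ultimately show "u \<in> W12_per T" "AE t in M. weak_derivative T u t = (\<Sum>j\<in>J. c j *\<^sub>R mode' j t)"
    by (rule C1_weak_derivative; simp)+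
  show "u t $ 1 = (\<Sum>j\<in>J. c j * harmonic j t)"
    by (simp add: u mode_def)
qed

lemma integral_square_sum:
  fixes \<phi> :: "nat \<Rightarrow> real \<Rightarrow> real"
  assumes "finite J" and "\<And>j. j \<in> J \<Longrightarrow> continuous_on UNIV (\<phi> j)"
    and "\<And>i j. i \<in> J \<Longrightarrow> j \<in> J \<Longrightarrow> (\<integral>t. \<phi> i t * \<phi> j t \<partial>M) = (if i = j then h j else 0)"
  shows "(\<integral>t. (\<Sum>j\<in>J. c j * \<phi> j t)\<^sup>2 \<partial>M) = (\<Sum>j\<in>J. (c j)\<^sup>2 * h j)"
  using integral_square_diff_sum[of J M "\<lambda>_. 0" \<phi> h c] assms
  by (simp add: continuous_square_integrable square_integrable_const)

text \<open>The first components are orthogonal, so the squared norm of a vanishing sum isolates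
  each squared coefficient.\<close>

lemma mode_loop_independent:
  assumes "finite J" "(\<Sum>j\<in>J. c j *\<^sub>R mode_loop j) = 0"
  shows "\<forall>j\<in>J. c j = 0"
proof -
  have "(\<Sum>j\<in>J. c j * harmonic j t) = 0" for t
    using mode_loop_sum(3)[of c J t] assms(2) by simp
  then have "(\<Sum>j\<in>J. (c j)\<^sup>2 * harmonic_norm j) = 0"
    using integral_square_sum[OF \<open>finite J\<close> continuous_harmonic harmonic_orthogonal, of c] by simp
  then have "\<forall>j\<in>J. (c j)\<^sup>2 * harmonic_norm j = 0"
    using \<open>finite J\<close> harmonic_norm_pos by (subst (asm) sum_nonneg_eq_0_iff) (auto simp: less_imp_le)
  then show ?thesis using harmonic_norm_pos by (auto simp: less_le)
qed

lemma form_mode_loop_sum: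
  assumes "finite J"
  shows "form (\<Sum>j\<in>J. c j *\<^sub>R mode_loop j)
    = (\<Sum>j\<in>J. (c j)\<^sup>2 * (harmonic_norm j * (p\<^sub>0 * (w * freq j)\<^sup>2 + d + (if j = 0 then \<eta> * b\<^sup>2 else 0))))"
proof -
  let ?u = "\<Sum>j\<in>J. c j *\<^sub>R mode_loop j"
  let ?A = "\<lambda>t. \<Sum>j\<in>J. c j * harmonic' j t" and ?B = "\<lambda>t. \<Sum>j\<in>J. c j * harmonic j t"
  \<comment> \<open>This is \<open>u2' + b u1\<close> for the sum: it cancels in every mode but the
    constant one, where it leaves \<open>b\<close>.\<close>
  let ?D = "\<lambda>t. \<Sum>j\<in>J. c j * (if j = 0 then b else 0)"
  have W: "?u \<in> W12_per T" by (rule mode_loop_sum)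
  have "form ?u = (\<integral>t. p\<^sub>0 * (?A t)\<^sup>2 + d * (?B t)\<^sup>2 + \<eta> * (?D t)\<^sup>2 \<partial>M)"
    unfolding form_def
  proof (rule integral_cong_AE)
    show "(\<lambda>t. p\<^sub>0 * (weak_derivative T ?u t $ 1)\<^sup>2 + d * (apply_bcontfun ?u t $ 1)\<^sup>2
      + \<eta> * (weak_derivative T ?u t $ 2 + b * apply_bcontfun ?u t $ 1)\<^sup>2) \<in> borel_measurable M"
      using L2_per_square_integrable[OF weak_derivative_spec(1)[OF W]] L2_per_square_integrable[OF W12_per_L2_per[OF W]]
      unfolding square_integrable_def
      by (intro borel_measurable_add borel_measurable_times borel_measurable_power borel_measurable_const) auto
    show "(\<lambda>t. p\<^sub>0 * (?A t)\<^sup>2 + d * (?B t)\<^sup>2 + \<eta> * (?D t)\<^sup>2) \<in> borel_measurable M"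
      by (intro borel_measurable_M borel_measurable_continuous_onI continuous_intros continuous_harmonic continuous_harmonic')
    show "AE t in M. p\<^sub>0 * (weak_derivative T ?u t $ 1)\<^sup>2 + d * (apply_bcontfun ?u t $ 1)\<^sup>2
      + \<eta> * (weak_derivative T ?u t $ 2 + b * apply_bcontfun ?u t $ 1)\<^sup>2
      = p\<^sub>0 * (?A t)\<^sup>2 + d * (?B t)\<^sup>2 + \<eta> * (?D t)\<^sup>2"
      using mode_loop_sum(2)[of c J]
    proof eventually_elim
      case (elim t)
      have "weak_derivative T ?u t $ 1 = ?A t"
        by (simp add: elim mode'_def)
      moreover have "weak_derivative T ?u t $ 2 + b * apply_bcontfun ?u t $ 1 = ?D t"
        unfolding elim mode_loop_sum(3) by (simp add: mode'_def sum_distrib_left flip: sum.distrib)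
          (intro sum.cong, auto)
      ultimately show ?case by (simp only: mode_loop_sum(3))
    qed
  qed
  also have "\<dots> = p\<^sub>0 * (\<integral>t. (?A t)\<^sup>2 \<partial>M) + d * (\<integral>t. (?B t)\<^sup>2 \<partial>M) + \<eta> * (\<integral>t. (?D t)\<^sup>2 \<partial>M)"
    by (subst Bochner_Integration.integral_add integral_mult_right_zero;
        (intro continuous_integrable continuous_intros continuous_harmonic continuous_harmonic')?)+ simp
  also have "(\<integral>t. (?A t)\<^sup>2 \<partial>M) = (\<Sum>j\<in>J. (c j)\<^sup>2 * ((w * freq j)\<^sup>2 * harmonic_norm j))"
    by (rule integral_square_sum[OF assms continuous_harmonic' harmonic'_orthogonal])
  also have "(\<integral>t. (?B t)\<^sup>2 \<partial>M) = (\<Sum>j\<in>J. (c j)\<^sup>2 * harmonic_norm j)"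
    by (rule integral_square_sum[OF assms continuous_harmonic harmonic_orthogonal])
  \<comment> \<open>These constants fit the orthogonality hypothesis because only the one of index 0
    can be nonzero.\<close>
  also have "(\<integral>t. (?D t)\<^sup>2 \<partial>M) = (\<Sum>j\<in>J. (c j)\<^sup>2 * (if j = 0 then b\<^sup>2 * T else 0))"
    using measure_M by (intro integral_square_sum[OF assms]) (auto simp: power2_eq_square space_M)
  finally show ?thesis
    by (simp add: sum_distrib_left flip: sum.distrib)
       (intro sum.cong refl, auto simp: algebra_simps harmonic_norm_def)
qed

text \<open>A space of dimension above \<open>card J\<close> contains a nonzero loop whose
  coefficients on \<open>J\<close> vanish, where the form is nonnegative; the modes of
  \<open>J\<close> attain the bound. For \<open>k = 0\<close> no nonconstant mode takes part, so the
  second condition is void.\<close>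

lemma max_negative_dimension:
  fixes k :: nat
  assumes k: "p\<^sub>0 * (w * (real k + 1))\<^sup>2 + d \<ge> 0" "k > 0 \<Longrightarrow> p\<^sub>0 * (w * real k)\<^sup>2 + d < 0"
  shows "Sup {enat (dim V) | V. subspace V \<and> V \<subseteq> W12_per T \<and> (\<exists>B. finite B \<and> V = span B) \<and>
             (\<forall>u\<in>V. u \<noteq> 0 \<longrightarrow> form u < 0)}
    = enat (2 * k + (if d + \<eta> * b\<^sup>2 < 0 then 1 else 0))" (is "Sup ?S = enat ?n")
proof (rule antisym)
  define J where "J = (if d + \<eta> * b\<^sup>2 < 0 then {0..2 * k} else {1..2 * k})"
  have J: "finite J" "card J = ?n" by (auto simp: J_def)
  show "Sup ?S \<le> enat ?n"
  proof (rule Sup_least)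
    fix n assume "n \<in> ?S"
    then obtain B where B: "n = enat (dim (span B))" "span B \<subseteq> W12_per T" "finite B"
      "\<forall>u\<in>span B. u \<noteq> 0 \<longrightarrow> form u < 0"
      by blast
    have "dim (span B) \<le> ?n"
    proof (rule ccontr)
      assume "\<not> dim (span B) \<le> ?n"
      then have "card J < dim (span B)" by (simp only: J not_le)
      then obtain u where u: "u \<in> span B" "u \<noteq> 0" "\<forall>j\<in>J. harmonic_coeff j u = 0"
        by (rule ex_nonzero_annihilated[OF B(3) J(1) _ linear_harmonic_coeff mode_loop_independent[OF J(1)]])
      have "form u \<ge> 0"
        by (rule form_nonneg[OF _ _ k(1)]) (use u B(2) in \<open>auto simp: J_def split: if_splits\<close>)
      then show False using B(4) u by force
    qed
    then show "n \<le> enat ?n" by (simp add: B(1))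
  qed
  \<comment> \<open>Among the nonconstant modes of \<open>J\<close> the highest frequency
    \<open>k\<close> is the least negative, so its sign decides; index 0 is present only when its
    own value is negative.\<close>
  have neg: "p\<^sub>0 * (w * freq j)\<^sup>2 + d + (if j = 0 then \<eta> * b\<^sup>2 else 0) < 0" if "j \<in> J" for j
  proof (cases "j = 0")
    case True
    then show ?thesis using that by (auto simp: J_def split: if_splits)
  next
    case False
    then have "freq j \<le> k" "k > 0" using that by (auto simp: J_def freq_le_iff split: if_splits)
    then have "p\<^sub>0 * (w * freq j)\<^sup>2 \<le> p\<^sub>0 * (w * real k)\<^sup>2"
      using p\<^sub>0_pos w_pos by (intro mult_left_mono power_mono) auto
    then show ?thesis using k(2)[OF \<open>k > 0\<close>] False by simp
  qed
  note span = span_image_eq_sums[OF J(1), of mode_loop]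
  have "form u < 0" if u: "u \<in> span (mode_loop ` J)" "u \<noteq> 0" for u
  proof -
    from u(1) obtain c where c: "u = (\<Sum>j\<in>J. c j *\<^sub>R mode_loop j)" unfolding span by blast
    obtain i where i: "i \<in> J" "c i \<noteq> 0"
      using u(2) unfolding c by (metis (mono_tags, lifting) scaleR_eq_0_iff sum.neutral)
    let ?l = "\<lambda>j. harmonic_norm j * (p\<^sub>0 * (w * freq j)\<^sup>2 + d + (if j = 0 then \<eta> * b\<^sup>2 else 0))"
    have l: "?l j < 0" if "j \<in> J" for j
      using neg[OF that] harmonic_norm_pos[of j] by (simp add: mult_pos_neg)
    have "0 < (\<Sum>j\<in>J. (c j)\<^sup>2 * - ?l j)"
    proof (rule sum_pos2[OF J(1) i(1)])
      show "0 < (c i)\<^sup>2 * - ?l i" using i l by (intro mult_pos_pos) auto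
      show "0 \<le> (c j)\<^sup>2 * - ?l j" if "j \<in> J" for j
        using l[OF that] by (intro mult_nonneg_nonneg) auto
    qed
    then show ?thesis
      unfolding c form_mode_loop_sum[OF J(1)] by (simp add: sum_negf)
  qed
  moreover have "span (mode_loop ` J) \<subseteq> W12_per T"
    unfolding span using mode_loop_sum(1) by blast
  moreover have "dim (span (mode_loop ` J)) = ?n"
    using span_family_independent(1)[OF J(1), of mode_loop] mode_loop_independent[OF J(1)] J(2) by metis
  ultimately have "enat ?n \<in> ?S"
    using J(1) by (intro CollectI exI[of _ "span (mode_loop ` J)"]) auto
  then show "enat ?n \<le> Sup ?S" by (rule Sup_upper)
qed

end

section \<open>Derivatives of the polar Lagrangian\<close>

text \<open>Stated as identities of functions so that they can be differentiated again; the
  Lagrangian is polynomial in the velocity.\<close>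

lemma partial_v_polar_lagrangian:
  "partial_v 1 (polar_lagrangian p q) = (\<lambda>x v. p (x $ 1) * v $ 1)"
  "partial_v 2 (polar_lagrangian p q) = (\<lambda>x v. eta p (x $ 1) * v $ 2)"
  unfolding partial_v_def polar_lagrangian_def eta_def
  by (intro ext DERIV_imp_deriv, auto intro!: derivative_eq_intros simp: axis_def)+

lemma DERIV_shift_0:
  fixes f :: "real \<Rightarrow> real"
  assumes "(f has_real_derivative f') (at r)"
  shows "((\<lambda>s. f (r + s)) has_real_derivative f') (at 0)"
  using assms DERIV_shift[of f f' 0 r] by (simp add: add.commute)

lemma partial_x_1_fun:
  assumes "(f has_real_derivative f') (at (x $ 1))"
  shows "partial_x 1 (\<lambda>x v. f (x $ 1) * h v) x v = f' * h v"
  unfolding partial_x_def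
  by (rule DERIV_imp_deriv) (use DERIV_shift_0[OF assms] in \<open>auto intro!: derivative_eq_intros simp: axis_def\<close>)

lemma partial_x_2_fun: "partial_x 2 (\<lambda>x v. g (x $ 1) v) x v = 0"
  unfolding partial_x_def by (simp add: axis_def)

lemma partial_x_polar_lagrangian:
  assumes p: "(p has_real_derivative p') (at (x $ 1))" and q: "(q has_real_derivative q') (at (x $ 1))"
  shows "partial_x 1 (polar_lagrangian p q) x v
    = p' * (v $ 1)\<^sup>2 / 2 + deriv (eta p) (x $ 1) * (v $ 2)\<^sup>2 / 2 + q'"
proof -
  have "((\<lambda>s. eta p (x $ 1 + s)) has_real_derivative deriv (eta p) (x $ 1)) (at 0)"
  proof (rule DERIV_shift_0)
    have "eta p field_differentiable at (x $ 1)"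
      unfolding eta_def[abs_def] field_differentiable_def
      by (rule exI) (auto intro!: derivative_eq_intros p)
    then show "(eta p has_real_derivative deriv (eta p) (x $ 1)) (at (x $ 1))"
      by (simp add: DERIV_deriv_iff_field_differentiable)
  qed
  note D = this DERIV_shift_0[OF p] DERIV_shift_0[OF q]
  have "((\<lambda>s. p (x $ 1 + s) * (v $ 1)\<^sup>2 / 2 + eta p (x $ 1 + s) * (v $ 2)\<^sup>2 / 2 + q (x $ 1 + s))
      has_real_derivative p' * (v $ 1)\<^sup>2 / 2 + deriv (eta p) (x $ 1) * (v $ 2)\<^sup>2 / 2 + q') (at 0)"
    by (auto intro!: derivative_eq_intros D)
  then show ?thesis
    unfolding partial_x_def polar_lagrangian_def eta_def
    by (intro DERIV_imp_deriv) (simp add: axis_def algebra_simps)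
qed

lemma smooth_on_has_derivative:
  assumes "smooth_on I f" "s \<in> I"
  shows "(f has_real_derivative deriv f s) (at s)" "(deriv f has_real_derivative deriv (deriv f) s) (at s)"
  using assms unfolding smooth_on_def DERIV_deriv_iff_field_differentiable
  by (auto dest: spec[of _ 0] spec[of _ 1])

lemma deriv_eta:
  assumes "smooth_on I p" "s \<in> I"
  shows "(eta p has_real_derivative deriv p s * s\<^sup>2 + p s * (2 * s)) (at s)"
    and "deriv (eta p) s = deriv p s * s\<^sup>2 + p s * (2 * s)"
proof -
  show "(eta p has_real_derivative deriv p s * s\<^sup>2 + p s * (2 * s)) (at s)"
    unfolding eta_def[abs_def] by (auto intro!: derivative_eq_intros smooth_on_has_derivative assms)
  then show "deriv (eta p) s = deriv p s * s\<^sup>2 + p s * (2 * s)"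
    by (rule DERIV_imp_deriv)
qed

text \<open>The formula for \<open>deriv (eta p)\<close> holds on \<open>I\<close>; openness lets it
  be differentiated at \<open>r\<close>.\<close>

lemma deriv_eta_differentiable:
  assumes "open I" "r \<in> I" "smooth_on I p"
  shows "(deriv (eta p) has_real_derivative deriv (deriv (eta p)) r) (at r)"
proof -
  have "((\<lambda>s. deriv p s * s\<^sup>2 + p s * (2 * s)) has_real_derivative
      deriv (deriv p) r * r\<^sup>2 + deriv p r * (2 * r) + (deriv p r * (2 * r) + p r * 2)) (at r)"
    by (auto intro!: derivative_eq_intros smooth_on_has_derivative assms)
  then have "(deriv (eta p) has_real_derivative
      deriv (deriv p) r * r\<^sup>2 + deriv p r * (2 * r) + (deriv p r * (2 * r) + p r * 2)) (at r)"
    by (rule has_field_derivative_transform_within_open[OF _ \<open>open I\<close>])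
       (use assms in \<open>auto simp: deriv_eta\<close>)
  then show ?thesis
    using DERIV_imp_deriv by fastforce
qed

text \<open>The angle does not occur in the Lagrangian, so every derivative in it vanishes. Where
  the radial velocity is zero, the only coupling left is that of the radius with the angular
  velocity.\<close>

lemma polar_second_derivatives:
  fixes p q :: "real \<Rightarrow> real" and x v :: "real^2"
  assumes "open I" "x $ 1 \<in> I"
    and p: "smooth_on I p" and q: "smooth_on I q"
  defines "L \<equiv> polar_lagrangian p q" and "r \<equiv> x $ 1"
  shows "(L_vv L x v *v y) \<bullet> y = p r * (y $ 1)\<^sup>2 + eta p r * (y $ 2)\<^sup>2"
    and "(L_vx L x v *v z) \<bullet> y = deriv p r * v $ 1 * z $ 1 * y $ 1 + deriv (eta p) r * v $ 2 * z $ 1 * y $ 2"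
    and "(L_xx L x v *v z) \<bullet> z = (deriv (deriv p) r * (v $ 1)\<^sup>2 / 2
      + deriv (deriv (eta p)) r * (v $ 2)\<^sup>2 / 2 + deriv (deriv q) r) * (z $ 1)\<^sup>2"
proof -
  note D = smooth_on_has_derivative[OF p] smooth_on_has_derivative[OF q]
  have r: "r \<in> I" using assms(2) by (simp add: r_def)
  have eta'': "(deriv (eta p) has_real_derivative deriv (deriv (eta p)) r) (at r)"
    by (rule deriv_eta_differentiable[OF \<open>open I\<close> r p])
  show "(L_vv L x v *v y) \<bullet> y = p r * (y $ 1)\<^sup>2 + eta p r * (y $ 2)\<^sup>2"
  proof -
    have "partial_v 1 (partial_v 1 L) x v = p r" "partial_v 2 (partial_v 1 L) x v = 0"
      "partial_v 1 (partial_v 2 L) x v = 0" "partial_v 2 (partial_v 2 L) x v = eta p r"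
      unfolding L_def r_def partial_v_polar_lagrangian unfolding partial_v_def
      by (intro DERIV_imp_deriv, auto intro!: derivative_eq_intros simp: axis_def)+
    then show ?thesis
      by (simp add: L_vv_def matrix_vector_mult_def inner_vec_def sum_2 power2_eq_square)
  qed
  show "(L_vx L x v *v z) \<bullet> y = deriv p r * v $ 1 * z $ 1 * y $ 1 + deriv (eta p) r * v $ 2 * z $ 1 * y $ 2"
  proof -
    have "partial_x 1 (partial_v 1 L) x v = deriv p r * v $ 1"
      unfolding L_def partial_v_polar_lagrangian
      using partial_x_1_fun[of p "deriv p r" x "\<lambda>v. v $ 1" v] D(1)[OF r] by (simp add: r_def)
    moreover have "partial_x 1 (partial_v 2 L) x v = deriv (eta p) r * v $ 2"
      unfolding L_def partial_v_polar_lagrangian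
      using partial_x_1_fun[of "eta p" "deriv (eta p) r" x "\<lambda>v. v $ 2" v] deriv_eta[OF p r]
      by (simp add: r_def)
    moreover have "partial_x 2 (partial_v i L) x v = 0" for i
      using partial_x_2_fun[of "\<lambda>s v. p s * v $ 1"] partial_x_2_fun[of "\<lambda>s v. eta p s * v $ 2"] exhaust_2[of i]
      by (auto simp: L_def partial_v_polar_lagrangian)
    ultimately show ?thesis
      by (simp add: L_vx_def matrix_vector_mult_def inner_vec_def sum_2)
  qed
  show "(L_xx L x v *v z) \<bullet> z = (deriv (deriv p) r * (v $ 1)\<^sup>2 / 2
      + deriv (deriv (eta p)) r * (v $ 2)\<^sup>2 / 2 + deriv (deriv q) r) * (z $ 1)\<^sup>2"
  proof -
    let ?g = "\<lambda>r. deriv p r * (v $ 1)\<^sup>2 / 2 + deriv (eta p) r * (v $ 2)\<^sup>2 / 2 + deriv q r"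
    let ?g' = "deriv (deriv p) r * (v $ 1)\<^sup>2 / 2 + deriv (deriv (eta p)) r * (v $ 2)\<^sup>2 / 2 + deriv (deriv q) r"
    have xs: "(x + s *\<^sub>R axis 1 1) $ 1 = r + s" "(x + s *\<^sub>R axis 2 1) $ 1 = r" for s
      by (simp_all add: axis_def r_def)
    have L': "partial_x 1 L y v = ?g (y $ 1)" if "y $ 1 \<in> I" for y
      unfolding L_def using partial_x_polar_lagrangian[OF D(1)[OF that] D(3)[OF that]] .
    have "(?g has_real_derivative ?g') (at r)"
      by (auto intro!: derivative_eq_intros D r eta'')
    then have g0: "((\<lambda>s. ?g (r + s)) has_real_derivative ?g') (at 0)"
      by (rule DERIV_shift_0)
    have "((\<lambda>s. partial_x 1 L (x + s *\<^sub>R axis 1 1) v) has_real_derivative ?g') (at 0)"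
    \<comment> \<open>The radial derivative equals \<open>?g\<close> for radii in \<open>I\<close>,
      and for small \<open>s\<close> the shifted radius stays in this open set.\<close>
    proof (rule has_field_derivative_transform_within_open[OF g0])
      show "open ((\<lambda>s. r + s) -` I)"
        by (intro open_vimage \<open>open I\<close> continuous_intros)
      show "?g (r + s) = partial_x 1 L (x + s *\<^sub>R axis 1 1) v" if "s \<in> (\<lambda>s. r + s) -` I" for s
        using L'[of "x + s *\<^sub>R axis 1 1"] that by (simp only: xs vimage_eq)
    qed (simp add: r)
    then have "partial_x 1 (partial_x 1 L) x v = ?g'"
      unfolding partial_x_def[of 1 "partial_x 1 L"] by (rule DERIV_imp_deriv)
    moreover have "partial_x 2 (partial_x 1 L) x v = 0"
    proof -
      have "partial_x 1 L (x + s *\<^sub>R axis 2 1) v = ?g r" for s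
        using L'[of "x + s *\<^sub>R axis 2 1"] r by (simp only: xs)
      then show ?thesis unfolding partial_x_def[of 2 "partial_x 1 L"] by simp
    qed
    moreover have "partial_x 2 L = (\<lambda>x v. 0)"
      unfolding L_def partial_x_def polar_lagrangian_def by (simp add: axis_def)
    then have "partial_x i (partial_x 2 L) x v = 0" for i
      by (simp add: partial_x_def)
    ultimately show ?thesis
      by (simp add: L_xx_def matrix_vector_mult_def inner_vec_def sum_2 power2_eq_square)
  qed
qed

lemma velocity_circular: "velocity (\<lambda>t. vector [\<xi>\<^sub>0, \<theta>\<^sub>0 + \<omega> * t] :: real^2) t = vector [0, \<omega>]"
proof -
  have eq: "(\<lambda>t. vector [\<xi>\<^sub>0, \<theta>\<^sub>0 + \<omega> * t] :: real^2) = (\<lambda>t. vector [\<xi>\<^sub>0, \<theta>\<^sub>0] + t *\<^sub>R vector [0, \<omega>])"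
    by (simp add: fun_eq_iff vec_eq_iff forall_2 mult.commute)
  show ?thesis
    unfolding velocity_def eq
    by (rule vector_derivative_at) (auto intro!: derivative_eq_intros)
qed

text \<open>The radius is constant, so the radial momentum is identically zero and the radial force
  must vanish.\<close>

lemma circular_solution_radial_equation:
  assumes "circular_solution p q I \<xi>\<^sub>0 \<omega> x" and "smooth_on I p" "smooth_on I q"
  shows "deriv q \<xi>\<^sub>0 = - deriv (eta p) \<xi>\<^sub>0 * \<omega>\<^sup>2 / 2"
proof -
  let ?L = "polar_lagrangian p q"
  obtain \<theta>\<^sub>0 where x: "x = (\<lambda>t. vector [\<xi>\<^sub>0, \<theta>\<^sub>0 + \<omega> * t])"
    using assms(1) unfolding circular_solution_def by blast
  have \<xi>: "\<xi>\<^sub>0 \<in> I" and el: "solves_euler_lagrange ?L x"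
    using assms(1) by (auto simp: circular_solution_def)
  note D = smooth_on_has_derivative(1)[OF assms(2) \<xi>] smooth_on_has_derivative(1)[OF assms(3) \<xi>]
  have "((\<lambda>s. partial_v 1 ?L (x s) (velocity x s)) has_real_derivative
      partial_x 1 ?L (x 0) (velocity x 0)) (at 0)"
    using el by (simp add: solves_euler_lagrange_def)
  moreover have "partial_v 1 ?L (x s) (velocity x s) = 0" for s
    unfolding partial_v_polar_lagrangian x velocity_circular by simp
  ultimately have "((\<lambda>s. 0) has_real_derivative partial_x 1 ?L (x 0) (velocity x 0)) (at 0)"
    by simp
  then have "partial_x 1 ?L (x 0) (velocity x 0) = 0"
    using DERIV_const by (rule DERIV_unique)
  moreover have "partial_x 1 ?L (x 0) (velocity x 0) = deriv (eta p) \<xi>\<^sub>0 * \<omega>\<^sup>2 / 2 + deriv q \<xi>\<^sub>0"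
    using partial_x_polar_lagrangian[of p "deriv p \<xi>\<^sub>0" "x 0" q "deriv q \<xi>\<^sub>0"] D
    unfolding x velocity_circular by simp
  ultimately show ?thesis by simp
qed

section \<open>Identification of the constants and the frequency count\<close>

theorem theorem1:
  fixes p q :: "real \<Rightarrow> real" and I :: "real set"
    and \<xi>\<^sub>0 \<omega> T a b c d :: real and x :: "real \<Rightarrow> real^2"
  assumes "open I" and "is_interval I" and "I \<subseteq> {0<..}"
    and "smooth_on I p" and "smooth_on I q" and "\<forall>\<xi>\<in>I. p \<xi> > 0"
    and "circular_solution p q I \<xi>\<^sub>0 \<omega> x"
    and "T = 2 * pi / \<omega>"
    and "a = coef_a p \<xi>\<^sub>0" and "b = coef_b p q \<xi>\<^sub>0" and "c = coef_c p \<xi>\<^sub>0" and "d = coef_d p q \<xi>\<^sub>0"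
  shows "(d < 0 \<longrightarrow>
            (\<exists>!k::nat. 2 * pi * real k < sqrt (- a * d) * T \<and>
                       sqrt (- a * d) * T \<le> 2 * pi * (real k + 1)) \<and>
            (\<forall>k::nat. 2 * pi * real k < sqrt (- a * d) * T \<and>
                      sqrt (- a * d) * T \<le> 2 * pi * (real k + 1) \<longrightarrow>
               (c * d + b\<^sup>2 \<ge> 0 \<longrightarrow>
                  morse_index (polar_lagrangian p q) T x = enat (2 * k)) \<and>
               (c * d + b\<^sup>2 < 0 \<longrightarrow>
                  morse_index (polar_lagrangian p q) T x = enat (2 * k + 1)))) \<and>
         ((d = 0 \<and> b = 0 \<and> c > 0) \<or> (d = 0 \<and> b \<noteq> 0) \<or> (d > 0 \<and> c * d + b\<^sup>2 > 0) \<longrightarrow>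
            morse_index (polar_lagrangian p q) T x = 0)"
proof -
  let ?L = "polar_lagrangian p q"
  let ?p = "p \<xi>\<^sub>0" and ?\<eta> = "eta p \<xi>\<^sub>0" and ?\<eta>' = "deriv (eta p) \<xi>\<^sub>0" and ?\<eta>'' = "deriv (deriv (eta p)) \<xi>\<^sub>0"
    and ?q' = "deriv q \<xi>\<^sub>0" and ?q'' = "deriv (deriv q) \<xi>\<^sub>0"
  have \<xi>: "\<xi>\<^sub>0 \<in> I" "\<xi>\<^sub>0 > 0" and \<omega>: "\<omega> > 0" and \<eta>': "?\<eta>' \<noteq> 0"
    and p: "?p > 0" and "\<exists>\<theta>\<^sub>0. \<forall>t. x t = vector [\<xi>\<^sub>0, \<theta>\<^sub>0 + \<omega> * t]"
    using assms by (auto simp: circular_solution_def)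
  then obtain \<theta>\<^sub>0 where x: "x = (\<lambda>t. vector [\<xi>\<^sub>0, \<theta>\<^sub>0 + \<omega> * t])" by blast
  have \<eta>: "?\<eta> > 0" using p \<xi> by (simp add: eta_def)
  have q': "?q' = - ?\<eta>' * \<omega>\<^sup>2 / 2"
    by (rule circular_solution_radial_equation[OF assms(7,4,5)])
  \<comment> \<open>The case distinction in \<open>zeta\<close> follows the sign of
    \<open>?\<eta>'\<close>, which removes the absolute value produced by the square root.\<close>
  have b: "b = ?\<eta>' * \<omega> / ?\<eta>"
  proof -
    have "- 2 * ?q' * ?\<eta>' = (?\<eta>' * \<omega>)\<^sup>2"
      unfolding q' by (simp add: power2_eq_square)
    then have "zeta p q \<xi>\<^sub>0 = ?\<eta>' * \<omega>"
      unfolding zeta_def using \<omega> by (simp add: abs_mult)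
    then show ?thesis using assms(10) by (simp add: coef_b_def field_simps)
  qed
  \<comment> \<open>The first term of \<open>coef_d\<close> is minus
    \<open>?\<eta> * b\<^sup>2\<close>, which completing the square subtracts; the second is the
    coefficient of \<open>L_xx\<close>.\<close>
  have d: "d = ?q'' + \<omega>\<^sup>2 * ?\<eta>'' / 2 - ?\<eta> * b\<^sup>2"
  proof -
    have D: "(deriv q has_real_derivative ?q'') (at \<xi>\<^sub>0)" "(deriv (eta p) has_real_derivative ?\<eta>'') (at \<xi>\<^sub>0)"
      by (rule smooth_on_has_derivative[OF assms(5) \<xi>(1)] deriv_eta_differentiable[OF assms(1) \<xi>(1) assms(4)])+
    have "deriv (\<lambda>r. deriv q r / deriv (eta p) r) \<xi>\<^sub>0 = (?q'' * ?\<eta>' - ?q' * ?\<eta>'') / (?\<eta>' * ?\<eta>')"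
      using \<eta>' by (intro DERIV_imp_deriv DERIV_divide D)
    then have "d = 2 * ?q' * (?\<eta>' / ?\<eta>) + ?\<eta>' * ((?q'' * ?\<eta>' - ?q' * ?\<eta>'') / (?\<eta>' * ?\<eta>'))"
      using assms(12) by (simp add: coef_d_def)
    also have "\<dots> = ?q'' + \<omega>\<^sup>2 * ?\<eta>'' / 2 - ?\<eta> * b\<^sup>2"
      unfolding q' b using \<eta>' \<eta> by (simp add: field_simps power2_eq_square)
    finally show ?thesis .
  qed
  interpret radial_form \<omega> ?p ?\<eta> b d
    using \<omega> p \<eta> by unfold_locales
  have "second_variation ?L T x u = form u" for u
  proof -
    let ?v = "weak_derivative T u"
    have "(L_vv ?L (x t) (velocity x t) *v ?v t) \<bullet> ?v t + 2 * ((L_vx ?L (x t) (velocity x t) *v u t) \<bullet> ?v t)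
        + (L_xx ?L (x t) (velocity x t) *v u t) \<bullet> u t
      = ?p * (?v t $ 1)\<^sup>2 + d * (u t $ 1)\<^sup>2 + ?\<eta> * (?v t $ 2 + b * u t $ 1)\<^sup>2" for t
    proof -
      have x1: "x t $ 1 = \<xi>\<^sub>0" and v: "velocity x t $ 1 = 0" "velocity x t $ 2 = \<omega>"
        unfolding x velocity_circular by simp_all
      \<comment> \<open>This matches the mixed term from \<open>L_vx\<close> with the one produced
        by the square.\<close>
      have "?\<eta> * b = ?\<eta>' * \<omega>" using b \<eta> by simp
      then have "?p * r\<^sup>2 + ?\<eta> * s\<^sup>2 + 2 * (?\<eta>' * \<omega> * z * s) + (?\<eta>'' * \<omega>\<^sup>2 / 2 + ?q'') * z\<^sup>2
        = ?p * r\<^sup>2 + d * z\<^sup>2 + ?\<eta> * (s + b * z)\<^sup>2" for r s z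
        unfolding d by algebra
      then show ?thesis
        using polar_second_derivatives[OF \<open>open I\<close> _ assms(4,5), of "x t" "velocity x t"] \<xi>(1)
        by (simp add: x1 v)
    qed
    then show ?thesis
      unfolding second_variation_def form_def Let_def assms(8) set_integral_eq by simp
  qed
  then have index: "morse_index ?L T x = enat (2 * k + (if d + ?\<eta> * b\<^sup>2 < 0 then 1 else 0))"
    if "?p * (\<omega> * (real k + 1))\<^sup>2 + d \<ge> 0" "k > 0 \<Longrightarrow> ?p * (\<omega> * real k)\<^sup>2 + d < 0" for k
    unfolding morse_index_def assms(8) using max_negative_dimension[of k] that by simp
  \<comment> \<open>Up to the positive factor \<open>?\<eta>\<close>, this is the value of the form
    on constant radial variations.\<close>
  have cd: "c * d + b\<^sup>2 = (d + ?\<eta> * b\<^sup>2) / ?\<eta>"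
    using \<eta> assms(11) by (simp add: coef_c_def field_simps)
  \<comment> \<open>Here \<open>k = 0\<close> is admissible and the constant mode is not
    negative.\<close>
  have zero: "morse_index ?L T x = 0" if "d \<ge> 0"
    using index[of 0] that p \<eta> by (simp add: zero_enat_def add_nonneg_nonneg not_less)
  have neg: "(\<exists>!k::nat. 2 * pi * real k < sqrt (- a * d) * T \<and> sqrt (- a * d) * T \<le> 2 * pi * (real k + 1)) \<and>
    (\<forall>k::nat. 2 * pi * real k < sqrt (- a * d) * T \<and> sqrt (- a * d) * T \<le> 2 * pi * (real k + 1) \<longrightarrow>
               (c * d + b\<^sup>2 \<ge> 0 \<longrightarrow> morse_index ?L T x = enat (2 * k)) \<and>
               (c * d + b\<^sup>2 < 0 \<longrightarrow> morse_index ?L T x = enat (2 * k + 1)))" if "d < 0"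
  proof -
    \<comment> \<open>\<open>y\<close> is the real frequency at which
      \<open>?p * (\<omega> * y)\<^sup>2 + d\<close> vanishes; the negative frequencies n >= 1 are
      those below \<open>y\<close>.\<close>
    define y where "y = sqrt (- d / ?p) / \<omega>"
    have dp: "- d / ?p > 0" using \<open>d < 0\<close> p by (intro divide_pos_pos) auto
    then have "y > 0" using \<omega> by (simp add: y_def)
    have "(\<omega> * y)\<^sup>2 = - d / ?p"
      unfolding y_def using dp \<omega> by (simp del: minus_divide_left)
    then have "?p * (\<omega> * y)\<^sup>2 = - d" using p by simp
    note y = \<open>y > 0\<close> this
    have "sqrt (- a * d) * T = 2 * pi * y"
      using assms(8,9) by (simp add: coef_a_def y_def field_simps)
    then have bounds: "2 * pi * real k < sqrt (- a * d) * T \<and> sqrt (- a * d) * T \<le> 2 * pi * (real k + 1)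
        \<longleftrightarrow> real k < y \<and> y \<le> real k + 1" for k
      by simp
    have "\<exists>!k::nat. real k < y \<and> y \<le> real k + 1"
    proof (rule ex1I)
      \<comment> \<open>The largest integer strictly below \<open>y\<close>, natural because
        \<open>y > 0\<close>; for integral \<open>y\<close> it is \<open>y - 1\<close>.\<close>
      show "real (nat (\<lceil>y\<rceil> - 1)) < y \<and> y \<le> real (nat (\<lceil>y\<rceil> - 1)) + 1"
        using y(1) by linarith
      show "k = nat (\<lceil>y\<rceil> - 1)" if "real k < y \<and> y \<le> real k + 1" for k
        using that by linarith
    qed
    moreover have "morse_index ?L T x = enat (2 * k + (if d + ?\<eta> * b\<^sup>2 < 0 then 1 else 0))"
      if "real k < y" "y \<le> real k + 1" for k
    proof (rule index)
      have "(\<omega> * y)\<^sup>2 \<le> (\<omega> * (real k + 1))\<^sup>2"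
        using that y(1) \<omega> by (intro power_mono mult_left_mono) auto
      then have "?p * (\<omega> * y)\<^sup>2 \<le> ?p * (\<omega> * (real k + 1))\<^sup>2"
        using p by simp
      then show "?p * (\<omega> * (real k + 1))\<^sup>2 + d \<ge> 0" using y(2) by simp
      have "(\<omega> * real k)\<^sup>2 < (\<omega> * y)\<^sup>2"
        using that \<omega> by (intro power_strict_mono) auto
      then have "?p * (\<omega> * real k)\<^sup>2 < ?p * (\<omega> * y)\<^sup>2"
        using p by simp
      then show "?p * (\<omega> * real k)\<^sup>2 + d < 0" using y(2) by simp
    qed
    moreover have "c * d + b\<^sup>2 < 0 \<longleftrightarrow> d + ?\<eta> * b\<^sup>2 < 0"
      unfolding cd using \<eta> by (simp add: divide_less_0_iff)
    ultimately show ?thesis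
      unfolding bounds by (auto simp: not_le[symmetric])
  qed
  show ?thesis using neg zero by auto
qed

end
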